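(* Let $N_{-1}$ be a minimizing ths network, scaled such that $x_1=1$, and with lattice $\Lambda_0$. Then there is a continuous family of triply periodic networks $N_t\subset\mathbb R^3$, $t\in[-1,1]$, from $N_{-1}$ to a Steiner network $N_1$, with the following properties: (1) all $N_t$ have the same lattice $\Lambda_0$, and so the same volume $V$; (2) $N_t$ is a network with quotient graph $D_1\square D_2$ for $-1\le t<0$, and with quotient graph $K_4$ for $0<t\le 1$; (3) the length $t\mapsto L(N_t)$ is non-increasing, and $L(N_1)<L(N_{-1})$.
   Context: An ($n$-periodic) network $N$ (triply periodic if $n=3$) is a connected simple graph immersed with straight edges of positive length into $\mathbb R^n$ such that: $N$ is invariant under a lattice $\Lambda\subset\mathbb R^n$ of rank $n$, and the quotient $N/\Lambda$ is a finite graph, possibly with loops and multiple edges. "Immersed" means that for each vertex the restriction of the map to the union of the incident edges is injective. The length is $L(N)=L(N/\Lambda)$, the total edge length of the quotient, and the volume is $V=V(\mathbb R^n/\Lambda)$. A Steiner network is a network all of whose vertices have degree $3$, such that at each vertex the three unit edge vectors sum to zero (edges are coplanar and meet at $120^\circ$). $K_4$ is the complete graph on four vertices. $D_1\square D_2$ is the $3$-regular multigraph with four vertices $A,B,C,D$ and six edges: $e_1,e_2$ both joining $A$ and $B$; $e_3,e_4$ both joining $C$ and $D$; $e_5$ joining $A$ and $C$; $e_6$ joining $B$ and $D$. A minimizing ths network is a triply periodic Steiner network with quotient $D_1\square D_2$ whose edge lengths $x_i>0$ (of $e_i$) satisfy $x_1=x_2=x_3=x_4=2x_5+2x_6$, and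 for which the plane containing the edges at (lifts of) $A$ and the plane containing the edges at (lifts of) $C$ are perpendicular. A continuous family $N_t$ with fixed lattice $\Lambda_0$ means that $N_t$ is the $\Lambda_0$-orbit of finitely many straight segments joining generating vertices $p_i^t\in\mathbb R^3$ which depend continuously on $t$. The combinatorial type may change at $t=0$, where two vertices joined by an edge coincide, the segment between them having length $0$ there (so $N_0$ has one vertex of degree $4$ in the quotient). *)

theory Defs
  imports "HOL-Analysis.Analysis"
begin

definition lattice_basis :: "('n \<Rightarrow> real^'n) \<Rightarrow> (real^'n) set \<Rightarrow> bool" where
  "lattice_basis b \<Lambda> \<longleftrightarrow> inj b \<and> independent (range b) \<and>
     \<Lambda> = range (\<lambda>k :: 'n \<Rightarrow> int. \<Sum>i\<in>UNIV. of_int (k i) *\<^sub>R b i)"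

definition is_lattice :: "(real^'n) set \<Rightarrow> bool" where
  "is_lattice \<Lambda> \<longleftrightarrow> (\<exists>b. lattice_basis b \<Lambda>)"

text \<open>Volume of the quotient torus, computed on the fundamental cell of some basis; the value
  does not depend on the basis.\<close>

definition covolume :: "(real^'n) set \<Rightarrow> real" where
  "covolume \<Lambda> = (let b = (SOME b. lattice_basis b \<Lambda>) in
     measure lebesgue {\<Sum>i\<in>UNIV. c i *\<^sub>R b i | c. \<forall>i. 0 \<le> c i \<and> c i < 1})"


text \<open>Undirected multigraphs. An edge is mapped to the set of its end points, a singleton if the
  edge is a loop.\<close>

record ('v, 'e) multigraph =
  mverts :: "'v set"
  medges :: "'e set"
  mends :: "'e \<Rightarrow> 'v set"

definition multigraph_iso ::
  "('v, 'e) multigraph \<Rightarrow> ('w, 'd) multigraph \<Rightarrow> ('v \<Rightarrow> 'w) \<Rightarrow> ('e \<Rightarrow> 'd) \<Rightarrow> bool" where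
  "multigraph_iso G H f g \<longleftrightarrow>
     bij_betw f (mverts G) (mverts H) \<and> bij_betw g (medges G) (medges H) \<and>
     (\<forall>e\<in>medges G. mends H (g e) = f ` mends G e)"

definition multigraph_isomorphic :: "('v, 'e) multigraph \<Rightarrow> ('w, 'd) multigraph \<Rightarrow> bool" where
  "multigraph_isomorphic G H \<longleftrightarrow> (\<exists>f g. multigraph_iso G H f g)"

text \<open>Loops count twice.\<close>

definition mdegree :: "('v, 'e) multigraph \<Rightarrow> 'v \<Rightarrow> nat" where
  "mdegree G v = card {e \<in> medges G. v \<in> mends G e} + card {e \<in> medges G. mends G e = {v}}"

definition complete_multigraph :: "nat \<Rightarrow> (nat, nat set) multigraph" where
  "complete_multigraph n =
     \<lparr>mverts = {..<n}, medges = {e. e \<subseteq> {..<n} \<and> card e = 2}, mends = (\<lambda>e. e)\<rparr>"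

abbreviation K4 :: "(nat, nat set) multigraph" where
  "K4 \<equiv> complete_multigraph 4"

datatype dvertex = VA | VB | VC | VD

text \<open>The graph \<open>D\<^sub>1 \<box> D\<^sub>2\<close>; the number \<open>i\<close> stands for the edge \<open>e\<^sub>i\<close>.\<close>

definition D1_box_D2 :: "(dvertex, nat) multigraph" where
  "D1_box_D2 =
     \<lparr>mverts = {VA, VB, VC, VD}, medges = {1..6},
      mends = (\<lambda>i. if i = 1 \<or> i = 2 then {VA, VB}
                   else if i = 3 \<or> i = 4 then {VC, VD}
                   else if i = 5 then {VA, VC}
                   else {VB, VD})\<rparr>"


text \<open>A periodic network is an abstract simple graph with a position map into \<open>\<real>\<^sup>n\<close>. The position
  map need not be injective on vertices, so the way the lattice acts on the abstract graph
  (lifting the translations) is part of the data.\<close>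

record ('a, 'n::finite) network =
  verts :: "'a set"
  edges :: "'a set set"
  pos :: "'a \<Rightarrow> real^'n"
  lat :: "(real^'n) set"
  act :: "real^'n \<Rightarrow> 'a \<Rightarrow> 'a"

definition simple_graph :: "('a, 'n::finite) network \<Rightarrow> bool" where
  "simple_graph N \<longleftrightarrow> (\<forall>e\<in>edges N. e \<subseteq> verts N \<and> card e = 2)"

definition connected_graph :: "('a, 'n::finite) network \<Rightarrow> bool" where
  "connected_graph N \<longleftrightarrow> verts N \<noteq> {} \<and>
     (\<forall>u\<in>verts N. \<forall>v\<in>verts N. (u, v) \<in> {(x, y). {x, y} \<in> edges N}\<^sup>*)"

definition neighbours :: "('a, 'n::finite) network \<Rightarrow> 'a \<Rightarrow> 'a set" where
  "neighbours N v = {u. {v, u} \<in> edges N}"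

text \<open>Each edge has positive length, hence is embedded, and two different edges at a vertex have
  only that vertex in common: the map is injective on the star of each vertex.\<close>

definition immersed :: "('a, 'n::finite) network \<Rightarrow> bool" where
  "immersed N \<longleftrightarrow> (\<forall>v\<in>verts N.
     (\<forall>u\<in>neighbours N v. pos N u \<noteq> pos N v) \<and>
     (\<forall>u\<in>neighbours N v. \<forall>w\<in>neighbours N v. u \<noteq> w \<longrightarrow>
        closed_segment (pos N v) (pos N u) \<inter> closed_segment (pos N v) (pos N w) = {pos N v}))"

definition lattice_invariant :: "('a, 'n::finite) network \<Rightarrow> bool" where
  "lattice_invariant N \<longleftrightarrow> is_lattice (lat N) \<and>
     (\<forall>v\<in>verts N. act N 0 v = v) \<and>
     (\<forall>l\<in>lat N. \<forall>m\<in>lat N. \<forall>v\<in>verts N. act N (l + m) v = act N l (act N m v)) \<and>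
     (\<forall>l\<in>lat N. \<forall>v\<in>verts N. act N l v \<in> verts N \<and> pos N (act N l v) = pos N v + l) \<and>
     (\<forall>l\<in>lat N. \<forall>e\<in>edges N. act N l ` e \<in> edges N)"

definition vertex_orbit :: "('a, 'n::finite) network \<Rightarrow> 'a \<Rightarrow> 'a set" where
  "vertex_orbit N v = (\<lambda>l. act N l v) ` lat N"

definition edge_orbit :: "('a, 'n::finite) network \<Rightarrow> 'a set \<Rightarrow> 'a set set" where
  "edge_orbit N e = (\<lambda>l. act N l ` e) ` lat N"

definition quotient_graph :: "('a, 'n::finite) network \<Rightarrow> ('a set, 'a set set) multigraph" where
  "quotient_graph N =
     \<lparr>mverts = vertex_orbit N ` verts N,
      medges = edge_orbit N ` edges N,
      mends = (\<lambda>E. vertex_orbit N ` \<Union>E)\<rparr>"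

definition periodic_network :: "('a, 'n::finite) network \<Rightarrow> bool" where
  "periodic_network N \<longleftrightarrow>
     simple_graph N \<and> connected_graph N \<and> immersed N \<and> lattice_invariant N \<and>
     finite (mverts (quotient_graph N)) \<and> finite (medges (quotient_graph N))"

definition edge_length :: "('a, 'n::finite) network \<Rightarrow> 'a set \<Rightarrow> real" where
  "edge_length N e = (THE d. \<exists>u v. e = {u, v} \<and> d = dist (pos N u) (pos N v))"

text \<open>All edges in an orbit have the same length.\<close>

definition orbit_length :: "('a, 'n::finite) network \<Rightarrow> 'a set set \<Rightarrow> real" where
  "orbit_length N E = edge_length N (SOME e. e \<in> E)"

definition network_length :: "('a, 'n::finite) network \<Rightarrow> real" where
  "network_length N = (\<Sum>E\<in>medges (quotient_graph N). orbit_length N E)"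

definition network_volume :: "('a, 'n::finite) network \<Rightarrow> real" where
  "network_volume N = covolume (lat N)"

definition steiner_network :: "('a, 'n::finite) network \<Rightarrow> bool" where
  "steiner_network N \<longleftrightarrow> periodic_network N \<and>
     (\<forall>v\<in>verts N. card (neighbours N v) = 3 \<and>
        (\<Sum>u\<in>neighbours N v. sgn (pos N u - pos N v)) = 0)"


text \<open>The direction space of the plane spanned by the edges at a vertex.\<close>

definition edge_plane :: "('a, 'n::finite) network \<Rightarrow> 'a \<Rightarrow> (real^'n) set" where
  "edge_plane N v = span {pos N u - pos N v | u. u \<in> neighbours N v}"

text \<open>Two planes in \<open>\<real>\<^sup>3\<close> are perpendicular if their normals are.\<close>

definition perpendicular_planes :: "(real^3) set \<Rightarrow> (real^3) set \<Rightarrow> bool" where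
  "perpendicular_planes P Q \<longleftrightarrow>
     (\<forall>m\<in>orthogonal_comp P. \<forall>n\<in>orthogonal_comp Q. orthogonal m n)"

text \<open>The isomorphism \<open>(f, g)\<close> labels the vertices and edges of the quotient.\<close>

definition minimizing_ths ::
  "('a, 3) network \<Rightarrow> (dvertex \<Rightarrow> 'a set) \<Rightarrow> (nat \<Rightarrow> 'a set set) \<Rightarrow> bool" where
  "minimizing_ths N f g \<longleftrightarrow>
     steiner_network N \<and> multigraph_iso D1_box_D2 (quotient_graph N) f g \<and>
     (let x = (\<lambda>i. orbit_length N (g i)) in
        x 1 = x 2 \<and> x 2 = x 3 \<and> x 3 = x 4 \<and> x 4 = 2 * x 5 + 2 * x 6) \<and>
     (\<forall>v\<in>f VA. \<forall>w\<in>f VC. perpendicular_planes (edge_plane N v) (edge_plane N w))"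


text \<open>\<open>N\<close> is the lattice orbit of finitely many segments: the vertices are the translates of the
  generating vertices \<open>q i\<close>, and \<open>(i, j, m) \<in> S\<close> stands for the segment from \<open>q i\<close> to the
  \<open>m\<close>-translate of \<open>q j\<close>. A segment whose two ends are the same vertex has length zero and
  contributes no edge.\<close>

definition segment_orbit ::
  "('a, 'n::finite) network \<Rightarrow> nat set \<Rightarrow> (nat \<Rightarrow> 'a) \<Rightarrow> (nat \<times> nat \<times> (real^'n)) set \<Rightarrow> bool" where
  "segment_orbit N I q S \<longleftrightarrow>
     finite I \<and> finite S \<and> S \<subseteq> I \<times> I \<times> lat N \<and>
     verts N = {act N l (q i) | l i. l \<in> lat N \<and> i \<in> I} \<and>
     edges N = {{act N l (q i), act N (l + m) (q j)} | l i j m.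
                  l \<in> lat N \<and> (i, j, m) \<in> S \<and> q i \<noteq> act N m (q j)}"

text \<open>The generating vertices are pairwise inequivalent.\<close>

definition nondegenerate ::
  "('a, 'n::finite) network \<Rightarrow> nat set \<Rightarrow> (nat \<Rightarrow> 'a) \<Rightarrow> bool" where
  "nondegenerate N I q \<longleftrightarrow>
     (\<forall>i\<in>I. \<forall>j\<in>I. \<forall>l\<in>lat N. q i = act N l (q j) \<longleftrightarrow> i = j \<and> l = 0)"

text \<open>Up to translation, the only coincidence among the generating vertices is that of the two
  ends of one segment of \<open>S\<close>.\<close>

definition one_segment_collapsed ::
  "('a, 'n::finite) network \<Rightarrow> nat set \<Rightarrow> (nat \<Rightarrow> 'a) \<Rightarrow> (nat \<times> nat \<times> (real^'n)) set \<Rightarrow> bool" where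
  "one_segment_collapsed N I q S \<longleftrightarrow>
     (\<exists>a b m. (a, b, m) \<in> S \<and> a \<noteq> b \<and>
        (\<forall>i\<in>I. \<forall>j\<in>I. \<forall>l\<in>lat N. q i = act N l (q j) \<longleftrightarrow>
           (i = j \<and> l = 0) \<or> (i = a \<and> j = b \<and> l = m) \<or> (i = b \<and> j = a \<and> l = - m)))"

text \<open>A continuous family over \<open>[-1, 1]\<close> with fixed lattice \<open>\<Lambda>\<close>. The combinatorial type is given
  by the segments \<open>S\<close> before and \<open>S'\<close> after the time \<open>0\<close>; both describe the network at time \<open>0\<close>,
  where one segment of each has length zero.\<close>

definition continuous_family :: "(real^'n) set \<Rightarrow> (real \<Rightarrow> ('a, 'n::finite) network) \<Rightarrow> bool" where
  "continuous_family \<Lambda> N \<longleftrightarrow>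
     (\<forall>t\<in>{-1..1}. periodic_network (N t) \<and> lat (N t) = \<Lambda>) \<and>
     (\<exists>I q S S'.
        (\<forall>i\<in>I. continuous_on {-1..1} (\<lambda>t. pos (N t) (q t i))) \<and>
        (\<forall>t\<in>{-1..0}. segment_orbit (N t) I (q t) S) \<and>
        (\<forall>t\<in>{0..1}. segment_orbit (N t) I (q t) S') \<and>
        (\<forall>t\<in>{-1..1}. t \<noteq> 0 \<longrightarrow> nondegenerate (N t) I (q t)) \<and>
        one_segment_collapsed (N 0) I (q 0) S \<and>
        one_segment_collapsed (N 0) I (q 0) S')"

end

theory Submission
  imports Defs
begin

text \<open>Let \<open>n\<close> be the direction of \<open>e\<^sub>5\<close>. The edges at \<open>A\<close> and at \<open>C\<close> span planes with orthonormal bases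
  \<open>a, n\<close> and \<open>c, n\<close>, where \<open>a\<close> and \<open>c\<close> are orthogonal by assumption; thus the network is explicit in
  the frame \<open>a, c, n\<close> up to the length \<open>x\<^sub>5 < 1/2\<close>. For \<open>t \<le> 0\<close> the edge \<open>e\<^sub>5\<close> shrinks to a point while the
  parallel edge \<open>e\<^sub>6\<close> grows by the same amount, and the length stays \<open>9/2\<close>. The resulting vertex of
  degree 4 is split in a different way, \<open>e\<^sub>1, e\<^sub>3\<close> on one side and \<open>e\<^sub>2, e\<^sub>4\<close> on the other, which gives the
  quotient \<open>K\<^sub>4\<close>. For \<open>t \<ge> 0\<close> the vertices move linearly to those of a Steiner network with the same
  lattice. Along this path the length is convex, and since the first variation vanishes at the Steiner
  network it is minimal at the end, hence decreasing. All angles between adjacent edges stay obtuse,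
  so that every network of the family is immersed.\<close>

section \<open>Quotients of oriented segment orbits\<close>

text \<open>The lattice survives the collapse because the scaling forces
  \<open>x_5 + x_6 = 1/2\<close>: length only slides from \<open>e_5\<close> to the parallel
  \<open>e_6\<close>, and the periods \<open>m2\<close>, \<open>m4\<close>, \<open>m6\<close> do not
  depend on \<open>x_5\<close>.

  At the vertex of degree 4, \<open>e_1\<close> and \<open>e_2\<close> still meet at 120 degrees, as
  do \<open>e_3\<close> and \<open>e_4\<close>, so splitting along \<open>n\<close> is neutral for
  the length. The angle between \<open>e_1\<close> and \<open>e_3\<close> has cosine -1/4 and lies
  below 120 degrees; pairing these instead shortens the network to first order.

  The second phase keeps a symmetry: \<open>A\<close> and \<open>C\<close> move oppositely along
  \<open>a + c\<close>, while \<open>B\<close> and \<open>D\<close> move only along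
  \<open>n\<close>. Two parameters remain, four edges stay equally long, and the length is the norm
  of an affine map plus an affine function. Hence it is convex, and Cauchy-Schwarz gives its minimum
  without derivatives.

  The family has to start at the given network itself, not at an isometric copy, and all its members
  live on one vertex type. Therefore the vertices and the lattice action of that network are reused,
  only positions and segments change, and the coordinate frame is abstract.\<close>

lemma lattice_zero: "is_lattice \<Lambda> \<Longrightarrow> 0 \<in> \<Lambda>"
  unfolding is_lattice_def lattice_basis_def
  by (auto intro!: image_eqI[where x = "\<lambda>_. 0"])

lemma lattice_add:
  assumes "is_lattice \<Lambda>" "l \<in> \<Lambda>" "m \<in> \<Lambda>"
  shows "l + m \<in> \<Lambda>"
proof -
  obtain b where \<Lambda>: "\<Lambda> = range (\<lambda>k :: 'a \<Rightarrow> int. \<Sum>i\<in>UNIV. of_int (k i) *\<^sub>R b i)"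
    using assms(1) unfolding is_lattice_def lattice_basis_def by blast
  obtain k k' where "l = (\<Sum>i\<in>UNIV. of_int (k i) *\<^sub>R b i)"
      "m = (\<Sum>i\<in>UNIV. of_int (k' i) *\<^sub>R b i)"
    using assms(2,3) unfolding \<Lambda> by blast
  then have "l + m = (\<Sum>i\<in>UNIV. of_int (k i + k' i) *\<^sub>R b i)"
    by (simp add: sum.distrib scaleR_add_left)
  then show ?thesis
    unfolding \<Lambda> by (intro image_eqI[where x = "\<lambda>i. k i + k' i"]) auto
qed

lemma lattice_uminus:
  assumes "is_lattice \<Lambda>" "l \<in> \<Lambda>"
  shows "- l \<in> \<Lambda>"
proof -
  obtain b where \<Lambda>: "\<Lambda> = range (\<lambda>k :: 'a \<Rightarrow> int. \<Sum>i\<in>UNIV. of_int (k i) *\<^sub>R b i)"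
    using assms(1) unfolding is_lattice_def lattice_basis_def by blast
  obtain k where "l = (\<Sum>i\<in>UNIV. of_int (k i) *\<^sub>R b i)"
    using assms(2) unfolding \<Lambda> by blast
  then have "- l = (\<Sum>i\<in>UNIV. of_int (- k i) *\<^sub>R b i)"
    by (simp add: sum_negf)
  then show ?thesis
    unfolding \<Lambda> by (intro image_eqI[where x = "\<lambda>i. - k i"]) auto
qed

text \<open>A common point \<open>z\<close> makes \<open>z - p\<close> a nonnegative multiple of
  both directions, so its square is a nonnegative multiple of a negative number. Immersion is
  thereby reduced to signs of inner products.\<close>

lemma closed_segments_meet_only_at_vertex:
  fixes p :: "'v :: real_inner"
  assumes "(x - p) \<bullet> (y - p) < 0"
  shows "closed_segment p x \<inter> closed_segment p y = {p}"
proof (intro equalityI subsetI)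
  fix z assume "z \<in> closed_segment p x \<inter> closed_segment p y"
  then obtain s t where st': "0 \<le> s" "z = (1 - s) *\<^sub>R p + s *\<^sub>R x" "0 \<le> t" "z = (1 - t) *\<^sub>R p + t *\<^sub>R y"
    by (auto simp: in_segment)
  have st: "0 \<le> s" "z - p = s *\<^sub>R (x - p)" "0 \<le> t" "z - p = t *\<^sub>R (y - p)"
    using st'(1,3) by (simp_all, subst st'(2), simp add: algebra_simps, subst st'(4), simp add: algebra_simps)
  have "(z - p) \<bullet> (z - p) = (s *\<^sub>R (x - p)) \<bullet> (t *\<^sub>R (y - p))"
    by (simp only: st(2)[symmetric] st(4)[symmetric])
  also have "\<dots> = s * t * ((x - p) \<bullet> (y - p))"
    by simp
  also have "\<dots> \<le> 0"
    using st assms by (simp add: mult_nonneg_nonpos)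
  finally show "z \<in> {p}"
    by (metis eq_iff_diff_eq_0 inner_eq_zero_iff inner_ge_zero order_antisym singletonI)
qed auto

lemma edge_length_pair: "edge_length N {u, v} = dist (pos N u) (pos N v)"
  unfolding edge_length_def
proof (rule the_equality)
  fix d assume "\<exists>u' v'. {u, v} = {u', v'} \<and> d = dist (pos N u') (pos N v')"
  then show "d = dist (pos N u) (pos N v)"
    by (auto simp: doubleton_eq_iff dist_commute)
qed blast

lemma multigraph_isomorphic_trans:
  assumes "multigraph_isomorphic G H" "multigraph_isomorphic H K"
  shows "multigraph_isomorphic G K"
proof -
  obtain f g f' g' where "multigraph_iso G H f g" "multigraph_iso H K f' g'"
    using assms unfolding multigraph_isomorphic_def by blast
  then have "multigraph_iso G K (f' \<circ> f) (g' \<circ> g)"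
    unfolding multigraph_iso_def
    by (auto intro: bij_betw_trans simp: image_comp bij_betwE)
  then show ?thesis
    unfolding multigraph_isomorphic_def by blast
qed

definition seg_edge :: "('a, 'n::finite) network \<Rightarrow> (nat \<Rightarrow> 'a) \<Rightarrow> nat \<times> nat \<times> (real^'n) \<Rightarrow> 'a set" where
  "seg_edge N q = (\<lambda>(i, j, m). {q i, act N m (q j)})"

definition segment_graph :: "nat set \<Rightarrow> (nat \<times> nat \<times> 'm) set \<Rightarrow> (nat, nat \<times> nat \<times> 'm) multigraph" where
  "segment_graph I S = \<lparr>mverts = I, medges = S, mends = (\<lambda>(i, j, m). {i, j})\<rparr>"

text \<open>The star of generator \<open>i\<close>, each neighbour coded by its generator and
  translation. A segment that ends at \<open>i\<close> is read backwards, hence the negated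
  translation.\<close>

definition incident :: "(nat \<times> nat \<times> 'm::group_add) set \<Rightarrow> nat \<Rightarrow> (nat \<times> 'm) set" where
  "incident S i = {(j, m) | j m. (i, j, m) \<in> S} \<union> {(j, - m) | j m. (j, i, m) \<in> S}"

text \<open>Kept apart from \<open>oriented_network\<close> because lifting the quotient of the
  given network uses these rules before any generating vertices are chosen.\<close>

locale lattice_network =
  fixes N :: "('a, 'n::finite) network"
  assumes inv: "lattice_invariant N"
begin

lemma zero_mem [simp]: "0 \<in> lat N"
  and add_mem [simp]: "l \<in> lat N \<Longrightarrow> m \<in> lat N \<Longrightarrow> l + m \<in> lat N"
  and uminus_mem [simp]: "l \<in> lat N \<Longrightarrow> - l \<in> lat N"
  and diff_mem [simp]: "l \<in> lat N \<Longrightarrow> m \<in> lat N \<Longrightarrow> l - m \<in> lat N"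
proof -
  have "is_lattice (lat N)"
    using inv by (simp add: lattice_invariant_def)
  note L = lattice_zero[OF this] lattice_add[OF this] lattice_uminus[OF this]
  show "0 \<in> lat N" "l \<in> lat N \<Longrightarrow> m \<in> lat N \<Longrightarrow> l + m \<in> lat N" "l \<in> lat N \<Longrightarrow> - l \<in> lat N"
    using L by auto
  show "l \<in> lat N \<Longrightarrow> m \<in> lat N \<Longrightarrow> l - m \<in> lat N"
    using L(2)[of l "- m"] L(3) by simp
qed

lemma act_zero [simp]: "v \<in> verts N \<Longrightarrow> act N 0 v = v"
  and act_act [simp]: "l \<in> lat N \<Longrightarrow> m \<in> lat N \<Longrightarrow> v \<in> verts N \<Longrightarrow>
    act N l (act N m v) = act N (l + m) v"
  and act_verts [simp]: "l \<in> lat N \<Longrightarrow> v \<in> verts N \<Longrightarrow> act N l v \<in> verts N"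
  and pos_act [simp]: "l \<in> lat N \<Longrightarrow> v \<in> verts N \<Longrightarrow> pos N (act N l v) = pos N v + l"
  and act_edges: "l \<in> lat N \<Longrightarrow> e \<in> edges N \<Longrightarrow> act N l ` e \<in> edges N"
proof -
  have A: "\<forall>v\<in>verts N. act N 0 v = v"
    using inv unfolding lattice_invariant_def by (elim conjE)
  have B: "\<forall>l\<in>lat N. \<forall>m\<in>lat N. \<forall>v\<in>verts N. act N (l + m) v = act N l (act N m v)"
    using inv unfolding lattice_invariant_def by (elim conjE)
  have C: "\<forall>l\<in>lat N. \<forall>v\<in>verts N. act N l v \<in> verts N \<and> pos N (act N l v) = pos N v + l"
    using inv unfolding lattice_invariant_def by (elim conjE)
  have D: "\<forall>l\<in>lat N. \<forall>e\<in>edges N. act N l ` e \<in> edges N"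
    using inv unfolding lattice_invariant_def by (elim conjE)
  show "v \<in> verts N \<Longrightarrow> act N 0 v = v"
    by (rule bspec[OF A])
  show "l \<in> lat N \<Longrightarrow> m \<in> lat N \<Longrightarrow> v \<in> verts N \<Longrightarrow> act N l (act N m v) = act N (l + m) v"
    using B[THEN bspec, THEN bspec, THEN bspec, of l m v] by (rule sym)
  show "l \<in> lat N \<Longrightarrow> v \<in> verts N \<Longrightarrow> act N l v \<in> verts N"
    by (rule conjunct1[OF C[THEN bspec, THEN bspec]])
  show "l \<in> lat N \<Longrightarrow> v \<in> verts N \<Longrightarrow> pos N (act N l v) = pos N v + l"
    by (rule conjunct2[OF C[THEN bspec, THEN bspec]])
  show "l \<in> lat N \<Longrightarrow> e \<in> edges N \<Longrightarrow> act N l ` e \<in> edges N"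
    by (rule D[THEN bspec, THEN bspec])
qed

lemma act_image_zero: "e \<subseteq> verts N \<Longrightarrow> act N 0 ` e = e"
  by (force simp: image_iff)

lemma act_act_image:
  "e \<subseteq> verts N \<Longrightarrow> l \<in> lat N \<Longrightarrow> m \<in> lat N \<Longrightarrow> act N l ` act N m ` e = act N (l + m) ` e"
  unfolding image_comp by (intro image_cong) auto

lemma edge_orbit_act:
  assumes "e \<subseteq> verts N" "l \<in> lat N"
  shows "edge_orbit N (act N l ` e) = edge_orbit N e"
proof (intro equalityI subsetI)
  fix x assume "x \<in> edge_orbit N (act N l ` e)"
  then show "x \<in> edge_orbit N e"
    using assms by (auto simp: edge_orbit_def act_act_image)
next
  fix x assume "x \<in> edge_orbit N e"
  then obtain k where "k \<in> lat N" "x = act N k ` e"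
    by (auto simp: edge_orbit_def)
  then have "x = act N (k - l) ` act N l ` e"
    using assms by (simp add: act_act_image)
  then show "x \<in> edge_orbit N (act N l ` e)"
    unfolding edge_orbit_def using \<open>k \<in> lat N\<close> assms by (intro rev_image_eqI[where x = "k - l"]) simp_all
qed

lemma vertex_orbit_act:
  assumes "v \<in> verts N" "l \<in> lat N"
  shows "vertex_orbit N (act N l v) = vertex_orbit N v"
proof -
  have "edge_orbit N (act N l ` {v}) = edge_orbit N {v}"
    using assms by (intro edge_orbit_act) auto
  moreover have "vertex_orbit N w = \<Union> (edge_orbit N {w})" for w
    by (auto simp: vertex_orbit_def edge_orbit_def)
  ultimately show ?thesis by simp
qed

end

text \<open>The order on the indices fixes an orientation of every segment; thus different segments lie in
  different edge orbits.\<close>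

locale oriented_network = lattice_network N
  for N :: "('a, 'n::finite) network" +
  fixes I :: "nat set" and q :: "nat \<Rightarrow> 'a" and S :: "(nat \<times> nat \<times> (real^'n)) set"
  assumes seg: "segment_orbit N I q S"
    and nd: "nondegenerate N I q"
    and ord: "\<And>i j m. (i, j, m) \<in> S \<Longrightarrow> i < j"
begin

lemma finite_I: "finite I" and finite_S: "finite S"
  and segD: "(i, j, m) \<in> S \<Longrightarrow> i \<in> I \<and> j \<in> I \<and> m \<in> lat N"
  using seg by (auto simp: segment_orbit_def)

lemma verts_eq: "verts N = {act N l (q i) | l i. l \<in> lat N \<and> i \<in> I}"
  using seg by (simp add: segment_orbit_def)

lemma q_verts [simp]: "i \<in> I \<Longrightarrow> q i \<in> verts N"
proof -
  assume "i \<in> I"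
  moreover then have "q i = act N 0 (q i)"
    using nd zero_mem unfolding nondegenerate_def by blast
  ultimately show "q i \<in> verts N"
    unfolding verts_eq using zero_mem by blast
qed

text \<open>Nondegeneracy makes pairs of translation and index into coordinates for the vertices.
  The injectivity claims about edges, orbits and neighbours reduce to this.\<close>

lemma act_q_eq_iff:
  assumes "i \<in> I" "j \<in> I" "l \<in> lat N" "k \<in> lat N"
  shows "act N l (q i) = act N k (q j) \<longleftrightarrow> i = j \<and> l = k"
proof
  assume "act N l (q i) = act N k (q j)"
  then have "act N (- l) (act N l (q i)) = act N (- l) (act N k (q j))"
    by simp
  then have "q i = act N (- l + k) (q j)"
    using assms by simp
  then have "i = j \<and> - l + k = 0"
    using nd assms unfolding nondegenerate_def by (metis add_mem uminus_mem)
  then show "i = j \<and> l = k"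
    by (metis add_eq_0_iff minus_minus)
qed simp

lemma edges_eq: "edges N = {act N l ` seg_edge N q s | l s. l \<in> lat N \<and> s \<in> S}"
proof -
  have ne: "q i \<noteq> act N m (q j)" if "(i, j, m) \<in> S" for i j m
    using act_q_eq_iff[of i j 0 m] segD[OF that] ord[OF that] by auto
  have "edges N = {{act N l (q i), act N (l + m) (q j)} | l i j m. l \<in> lat N \<and> (i, j, m) \<in> S}"
  proof -
    have "edges N = {{act N l (q i), act N (l + m) (q j)} | l i j m.
        l \<in> lat N \<and> (i, j, m) \<in> S \<and> q i \<noteq> act N m (q j)}"
      using seg unfolding segment_orbit_def by (elim conjE)
    also have "\<dots> = {{act N l (q i), act N (l + m) (q j)} | l i j m. l \<in> lat N \<and> (i, j, m) \<in> S}"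
      using ne by (intro Collect_cong ex_cong1) blast
    finally show ?thesis .
  qed
  also have "\<dots> = {act N l ` seg_edge N q s | l s. l \<in> lat N \<and> s \<in> S}"
  proof (intro Collect_cong iffI; elim exE conjE)
    fix e l i j m assume *: "e = {act N l (q i), act N (l + m) (q j)}" "l \<in> lat N" "(i, j, m) \<in> S"
    show "\<exists>l s. e = act N l ` seg_edge N q s \<and> l \<in> lat N \<and> s \<in> S"
      using * segD[OF *(3)] by (intro exI[of _ l] exI[of _ "(i, j, m)"]) (auto simp: seg_edge_def)
  next
    fix e l s assume *: "e = act N l ` seg_edge N q s" "l \<in> lat N" "s \<in> S"
    obtain i j m where s: "s = (i, j, m)" by (cases s)
    show "\<exists>l i j m. e = {act N l (q i), act N (l + m) (q j)} \<and> l \<in> lat N \<and> (i, j, m) \<in> S"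
      using * s segD[of i j m]
      by (intro exI[of _ l] exI[of _ i] exI[of _ j] exI[of _ m]) (auto simp: seg_edge_def)
  qed
  finally show ?thesis .
qed

lemma seg_edge_in_verts: "s \<in> S \<Longrightarrow> seg_edge N q s \<subseteq> verts N"
  using segD by (auto simp: seg_edge_def)

text \<open>A translate of one segment can match another only with equal or with exchanged ends. The
  order \<open>i < j\<close> excludes the exchange, and equal ends force the translation to
  vanish.\<close>

lemma edge_orbit_eq_iff:
  assumes "s \<in> S" "s' \<in> S"
  shows "edge_orbit N (seg_edge N q s) = edge_orbit N (seg_edge N q s') \<longleftrightarrow> s = s'"
proof
  assume eq: "edge_orbit N (seg_edge N q s) = edge_orbit N (seg_edge N q s')"
  obtain i j m i' j' m' where s: "s = (i, j, m)" "s' = (i', j', m')"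
    by (metis prod_cases3)
  note D = segD[of i j m] segD[of i' j' m'] ord[of i j m] ord[of i' j' m']
  have "seg_edge N q s \<in> edge_orbit N (seg_edge N q s)"
    using act_image_zero[OF seg_edge_in_verts[OF assms(1)]]
    unfolding edge_orbit_def by (metis image_eqI zero_mem)
  then obtain k where "k \<in> lat N" "seg_edge N q s = act N k ` seg_edge N q s'"
    unfolding eq by (auto simp: edge_orbit_def)
  then have "{act N 0 (q i), act N m (q j)} = {act N k (q i'), act N (k + m') (q j')}"
    using assms D by (simp add: seg_edge_def s)
  then show "s = s'"
    using assms D \<open>k \<in> lat N\<close> by (auto simp: s doubleton_eq_iff act_q_eq_iff simp del: act_zero)
qed simp

lemma vertex_orbit_eq_iff:
  assumes "i \<in> I" "j \<in> I"
  shows "vertex_orbit N (q i) = vertex_orbit N (q j) \<longleftrightarrow> i = j"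
proof
  assume eq: "vertex_orbit N (q i) = vertex_orbit N (q j)"
  have "act N 0 (q i) \<in> vertex_orbit N (q i)"
    by (simp add: vertex_orbit_def del: act_zero)
  then obtain k where "k \<in> lat N" "act N 0 (q i) = act N k (q j)"
    unfolding eq by (auto simp: vertex_orbit_def)
  then show "i = j"
    using assms by (simp add: act_q_eq_iff del: act_zero)
qed simp

lemma mverts_quotient: "mverts (quotient_graph N) = (\<lambda>i. vertex_orbit N (q i)) ` I"
proof -
  have "vertex_orbit N ` verts N = (\<lambda>i. vertex_orbit N (q i)) ` I"
  proof (intro equalityI subsetI)
    fix x assume "x \<in> vertex_orbit N ` verts N"
    then show "x \<in> (\<lambda>i. vertex_orbit N (q i)) ` I"
      unfolding verts_eq by (auto simp: vertex_orbit_act)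
  next
    fix x assume "x \<in> (\<lambda>i. vertex_orbit N (q i)) ` I"
    then show "x \<in> vertex_orbit N ` verts N" by auto
  qed
  then show ?thesis by (simp add: quotient_graph_def)
qed

lemma medges_quotient: "medges (quotient_graph N) = (\<lambda>s. edge_orbit N (seg_edge N q s)) ` S"
proof -
  have "edge_orbit N ` edges N = (\<lambda>s. edge_orbit N (seg_edge N q s)) ` S"
  proof (intro equalityI subsetI)
    fix x assume "x \<in> edge_orbit N ` edges N"
    then show "x \<in> (\<lambda>s. edge_orbit N (seg_edge N q s)) ` S"
      unfolding edges_eq by (auto simp: edge_orbit_act seg_edge_in_verts)
  next
    fix x assume "x \<in> (\<lambda>s. edge_orbit N (seg_edge N q s)) ` S"
    then obtain s where s: "s \<in> S" "x = edge_orbit N (seg_edge N q s)" by auto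
    have "seg_edge N q s \<in> edges N"
      unfolding edges_eq using s(1) act_image_zero[OF seg_edge_in_verts[OF s(1)], symmetric] zero_mem
      by blast
    then show "x \<in> edge_orbit N ` edges N" using s by auto
  qed
  then show ?thesis by (simp add: quotient_graph_def)
qed

lemma mends_quotient:
  assumes "(i, j, m) \<in> S"
  shows "mends (quotient_graph N) (edge_orbit N (seg_edge N q (i, j, m))) =
    {vertex_orbit N (q i), vertex_orbit N (q j)}"
proof -
  note D = segD[OF assms]
  have "\<Union> (edge_orbit N (seg_edge N q (i, j, m))) = vertex_orbit N (q i) \<union> vertex_orbit N (act N m (q j))"
    by (auto simp: edge_orbit_def seg_edge_def vertex_orbit_def)
  moreover have "vertex_orbit N ` vertex_orbit N v = {vertex_orbit N v}" if "v \<in> verts N" for v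
  proof -
    have "vertex_orbit N ` vertex_orbit N v = (\<lambda>l. vertex_orbit N v) ` lat N"
      unfolding vertex_orbit_def[of N v, THEN arg_cong[where f = "image (vertex_orbit N)"]] image_comp
      by (intro image_cong) (auto simp: vertex_orbit_act that)
    then show ?thesis by (simp add: image_constant[OF zero_mem])
  qed
  ultimately show ?thesis
    using D by (simp add: quotient_graph_def image_Un vertex_orbit_act insert_commute)
qed

lemma quotient_iso:
  "multigraph_iso (segment_graph I S) (quotient_graph N)
     (\<lambda>i. vertex_orbit N (q i)) (\<lambda>s. edge_orbit N (seg_edge N q s))"
proof -
  have "bij_betw (\<lambda>i. vertex_orbit N (q i)) I (mverts (quotient_graph N))"
    unfolding mverts_quotient bij_betw_def by (auto simp: inj_on_def vertex_orbit_eq_iff)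
  moreover have "bij_betw (\<lambda>s. edge_orbit N (seg_edge N q s)) S (medges (quotient_graph N))"
    unfolding medges_quotient bij_betw_def by (auto simp: inj_on_def edge_orbit_eq_iff)
  ultimately show ?thesis
    unfolding multigraph_iso_def by (auto simp: segment_graph_def mends_quotient)
qed

lemma orbit_length_seg:
  assumes "(i, j, m) \<in> S"
  shows "orbit_length N (edge_orbit N (seg_edge N q (i, j, m))) = dist (pos N (q i)) (pos N (q j) + m)"
proof -
  note D = segD[OF assms]
  \<comment> \<open>\<open>orbit_length\<close> measures an arbitrary edge of the orbit; it is a
    translate by some \<open>k\<close>, and \<open>k\<close> cancels in the distance.\<close>
  define e where "e = (SOME e. e \<in> edge_orbit N (seg_edge N q (i, j, m)))"
  have "e \<in> edge_orbit N (seg_edge N q (i, j, m))"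
    unfolding e_def by (rule someI[of _ "act N 0 ` seg_edge N q (i, j, m)"])
      (unfold edge_orbit_def, intro imageI zero_mem)
  then obtain k where "k \<in> lat N" "e = {act N k (q i), act N (k + m) (q j)}"
    using D by (auto simp: edge_orbit_def seg_edge_def)
  then have "edge_length N e = dist (pos N (q i) + k) ((pos N (q j) + m) + k)"
    using D by (simp add: edge_length_pair add_ac)
  then show ?thesis
    unfolding orbit_length_def e_def[symmetric] by simp
qed

lemma network_length_eq:
  "network_length N = (\<Sum>(i, j, m)\<in>S. dist (pos N (q i)) (pos N (q j) + m))"
proof -
  have "inj_on (\<lambda>s. edge_orbit N (seg_edge N q s)) S"
    by (auto simp: inj_on_def edge_orbit_eq_iff)
  then show ?thesis
    unfolding network_length_def medges_quotient
    by (simp add: sum.reindex, intro sum.cong) (auto simp: orbit_length_seg)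
qed

lemma mdegree_quotient:
  assumes "i \<in> I"
  shows "mdegree (quotient_graph N) (vertex_orbit N (q i)) =
    card {s \<in> S. fst s = i \<or> fst (snd s) = i}"
proof -
  let ?Q = "quotient_graph N" and ?v = "vertex_orbit N (q i)"
  have "?v \<in> mends ?Q (edge_orbit N (seg_edge N q s)) \<longleftrightarrow> fst s = i \<or> fst (snd s) = i" if "s \<in> S" for s
    using that assms segD[of "fst s" "fst (snd s)" "snd (snd s)"]
    by (cases s) (auto simp: mends_quotient vertex_orbit_eq_iff)
  then have "{e \<in> medges ?Q. ?v \<in> mends ?Q e} =
    (\<lambda>s. edge_orbit N (seg_edge N q s)) ` {s \<in> S. fst s = i \<or> fst (snd s) = i}"
    unfolding medges_quotient by blast
  moreover have "inj_on (\<lambda>s. edge_orbit N (seg_edge N q s)) {s \<in> S. fst s = i \<or> fst (snd s) = i}"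
    by (auto simp: inj_on_def edge_orbit_eq_iff)
  ultimately have 1: "card {e \<in> medges ?Q. ?v \<in> mends ?Q e} =
      card {s \<in> S. fst s = i \<or> fst (snd s) = i}"
    by (simp add: card_image)
  \<comment> \<open>The two ends of a segment lie in different orbits, so there are no loops and the
    second summand of \<open>mdegree\<close> is zero.\<close>
  have "vertex_orbit N (q j) \<noteq> vertex_orbit N (q k)" if "(j, k, m) \<in> S" for j k m
    using segD[OF that] ord[OF that] by (simp add: vertex_orbit_eq_iff)
  then have 2: "{e \<in> medges ?Q. mends ?Q e = {?v}} = {}"
    unfolding medges_quotient by (force simp: mends_quotient doubleton_eq_iff)
  show ?thesis
    unfolding mdegree_def 1 2 by simp
qed

lemma incidentD: "(j, m) \<in> incident S i \<Longrightarrow> i \<in> I \<and> j \<in> I \<and> m \<in> lat N \<and> i \<noteq> j"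
  unfolding incident_def by (auto dest: segD ord)

lemma neighbours_eq:
  assumes "i \<in> I" "l \<in> lat N"
  shows "neighbours N (act N l (q i)) = (\<lambda>(j, m). act N (l + m) (q j)) ` incident S i"
proof (intro equalityI subsetI)
  fix u assume "u \<in> neighbours N (act N l (q i))"
  then obtain k s where ks: "k \<in> lat N" "s \<in> S" "{act N l (q i), u} = act N k ` seg_edge N q s"
    unfolding neighbours_def edges_eq by auto
  obtain a b m where s: "s = (a, b, m)" by (cases s)
  note D = segD[OF ks(2)[unfolded s]]
  have "{act N l (q i), u} = {act N k (q a), act N (k + m) (q b)}"
    using ks D by (simp add: s seg_edge_def)
  then consider "i = a" "l = k" "u = act N (k + m) (q b)" | "i = b" "l = k + m" "u = act N k (q a)"
    using assms ks D by (auto simp: doubleton_eq_iff act_q_eq_iff)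
  then show "u \<in> (\<lambda>(j, m). act N (l + m) (q j)) ` incident S i"
  proof cases
    case 1
    then show ?thesis
      using ks s by (intro image_eqI[of _ _ "(b, m)"]) (auto simp: incident_def)
  next
    case 2
    then show ?thesis
      using ks s by (intro image_eqI[of _ _ "(a, - m)"]) (auto simp: incident_def)
  qed
next
  fix u assume "u \<in> (\<lambda>(j, m). act N (l + m) (q j)) ` incident S i"
  then obtain j m where u: "u = act N (l + m) (q j)" and jm: "(j, m) \<in> incident S i" by auto
  note D = incidentD[OF jm]
  from jm consider "(i, j, m) \<in> S" | "(j, i, - m) \<in> S"
    unfolding incident_def by auto
  then have "\<exists>k s. {act N l (q i), u} = act N k ` seg_edge N q s \<and> k \<in> lat N \<and> s \<in> S"
  proof cases
    case 1
    then show ?thesis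
      using assms D u by (intro exI[of _ l] exI[of _ "(i, j, m)"]) (simp add: seg_edge_def)
  next
    case 2
    then show ?thesis
      using assms D u
      by (intro exI[of _ "l + m"] exI[of _ "(j, i, - m)"]) (simp add: seg_edge_def insert_commute)
  qed
  then show "u \<in> neighbours N (act N l (q i))"
    unfolding neighbours_def edges_eq by simp
qed

lemma inj_on_incident:
  "l \<in> lat N \<Longrightarrow> inj_on (\<lambda>(j, m). act N (l + m) (q j)) (incident S i)"
  using incidentD by (fastforce simp: inj_on_def act_q_eq_iff)

lemma simple: "simple_graph N"
proof -
  have "e \<subseteq> verts N \<and> card e = 2" if "e \<in> edges N" for e
  proof -
    have "\<exists>l s. l \<in> lat N \<and> s \<in> S \<and> e = act N l ` seg_edge N q s"
      using that unfolding edges_eq by fast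
    then obtain l s where ls: "l \<in> lat N" "s \<in> S" "e = act N l ` seg_edge N q s"
      by blast
    obtain i j m where s: "s = (i, j, m)" by (cases s)
    note * = ls[unfolded s]
    then show ?thesis
      using segD[OF *(2)] ord[OF *(2)] by (auto simp: seg_edge_def card_2_iff' act_q_eq_iff)
  qed
  then show ?thesis by (simp add: simple_graph_def)
qed

definition star :: "nat \<Rightarrow> nat \<times> (real^'n) \<Rightarrow> real^'n" where
  "star i = (\<lambda>(j, m). pos N (q j) + m - pos N (q i))"

lemma pos_diff_star:
  assumes "jm \<in> incident S i" "l \<in> lat N"
  shows "pos N ((\<lambda>(j, m). act N (l + m) (q j)) jm) - pos N (act N l (q i)) = star i jm"
  using assms incidentD[of "fst jm" "snd jm" i] by (cases jm) (simp add: star_def)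

text \<open>Edge vectors are unchanged by translation (\<open>pos_diff_star\<close>), so it is
  enough to test the finitely many stars of the generators.\<close>

lemma immersedI:
  assumes nz: "\<And>i jm. i \<in> I \<Longrightarrow> jm \<in> incident S i \<Longrightarrow> star i jm \<noteq> 0"
    and obtuse: "\<And>i jm jm'. i \<in> I \<Longrightarrow> jm \<in> incident S i \<Longrightarrow> jm' \<in> incident S i \<Longrightarrow> jm \<noteq> jm' \<Longrightarrow>
      star i jm \<bullet> star i jm' < 0"
  shows "immersed N"
  unfolding immersed_def
proof (intro ballI conjI impI)
  fix v u assume *: "v \<in> verts N" "u \<in> neighbours N v"
  obtain l i where v: "l \<in> lat N" "i \<in> I" "v = act N l (q i)"
    using *(1) unfolding verts_eq by blast
  obtain jm where u: "jm \<in> incident S i" "u = (\<lambda>(j, m). act N (l + m) (q j)) jm"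
    using *(2) unfolding v(3) neighbours_eq[OF v(2,1)] by blast
  have "pos N u - pos N v \<noteq> 0"
    unfolding u(2) v(3) pos_diff_star[OF u(1) v(1)] by (rule nz[OF v(2) u(1)])
  then show "pos N u \<noteq> pos N v" by simp
next
  fix v u w assume *: "v \<in> verts N" "u \<in> neighbours N v" "w \<in> neighbours N v" "u \<noteq> w"
  obtain l i where v: "l \<in> lat N" "i \<in> I" "v = act N l (q i)"
    using *(1) unfolding verts_eq by blast
  obtain jm where u: "jm \<in> incident S i" "u = (\<lambda>(j, m). act N (l + m) (q j)) jm"
    using *(2) unfolding v(3) neighbours_eq[OF v(2,1)] by blast
  obtain jm' where w: "jm' \<in> incident S i" "w = (\<lambda>(j, m). act N (l + m) (q j)) jm'"
    using *(3) unfolding v(3) neighbours_eq[OF v(2,1)] by blast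
  have "jm \<noteq> jm'"
    using *(4) u(2) w(2) by blast
  then have "(pos N u - pos N v) \<bullet> (pos N w - pos N v) < 0"
    unfolding u(2) w(2) v(3) pos_diff_star[OF u(1) v(1)] pos_diff_star[OF w(1) v(1)]
    by (rule obtuse[OF v(2) u(1) w(1)])
  then show "closed_segment (pos N v) (pos N u) \<inter> closed_segment (pos N v) (pos N w) = {pos N v}"
    by (rule closed_segments_meet_only_at_vertex)
qed

lemma card_neighbours:
  "i \<in> I \<Longrightarrow> l \<in> lat N \<Longrightarrow> card (neighbours N (act N l (q i))) = card (incident S i)"
  by (simp add: neighbours_eq card_image inj_on_incident)

lemma sum_neighbours:
  assumes "i \<in> I" "l \<in> lat N"
  shows "(\<Sum>u\<in>neighbours N (act N l (q i)). sgn (pos N u - pos N (act N l (q i)))) =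
    (\<Sum>jm\<in>incident S i. sgn (star i jm))"
  unfolding neighbours_eq[OF assms] sum.reindex[OF inj_on_incident[OF assms(2)]] o_def
  by (intro sum.cong refl arg_cong[where f = sgn] pos_diff_star assms)

lemma steiner_iff:
  "steiner_network N \<longleftrightarrow> periodic_network N \<and>
     (\<forall>i\<in>I. card (incident S i) = 3 \<and> (\<Sum>jm\<in>incident S i. sgn (star i jm)) = 0)"
proof -
  have ball: "(\<forall>v\<in>verts N. P v) \<longleftrightarrow> (\<forall>i\<in>I. \<forall>l\<in>lat N. P (act N l (q i)))" for P
    unfolding verts_eq by blast
  have "(\<forall>v\<in>verts N. card (neighbours N v) = 3 \<and>
      (\<Sum>u\<in>neighbours N v. sgn (pos N u - pos N v)) = 0) \<longleftrightarrow>
    (\<forall>i\<in>I. \<forall>l\<in>lat N. card (incident S i) = 3 \<and> (\<Sum>jm\<in>incident S i. sgn (star i jm)) = 0)"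
    unfolding ball by (intro ball_cong refl) (simp only: card_neighbours sum_neighbours)
  then show ?thesis
    unfolding steiner_network_def using zero_mem by blast
qed

lemma periodicI: "connected_graph N \<Longrightarrow> immersed N \<Longrightarrow> periodic_network N"
  unfolding periodic_network_def
  by (simp add: simple inv mverts_quotient medges_quotient finite_I finite_S)

end

section \<open>Moving the generating vertices\<close>

text \<open>Edges may go to paths instead of edges: a rerouted edge becomes a detour, a collapsed
  one a constant path.\<close>

lemma connected_graph_image:
  assumes "connected_graph M" "h ` verts M = verts N"
    and edge: "\<And>u v. {u, v} \<in> edges M \<Longrightarrow> (h u, h v) \<in> {(x, y). {x, y} \<in> edges N}\<^sup>*"
  shows "connected_graph N"
proof -
  have "(h u, h v) \<in> {(x, y). {x, y} \<in> edges N}\<^sup>*" if "(u, v) \<in> {(x, y). {x, y} \<in> edges M}\<^sup>*" for u v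
    using that by (induction rule: rtrancl_induct) (auto intro: rtrancl_trans edge)
  then show ?thesis
    using assms(1) unfolding connected_graph_def assms(2)[symmetric] by blast
qed

text \<open>Positions are stored as displacements from \<open>M\<close>: with \<open>P i = pos M (q i)\<close> this gives back \<open>M\<close> itself,
  also outside its vertex set.\<close>

definition orbit_network ::
  "('a, 'n::finite) network \<Rightarrow> nat set \<Rightarrow> (nat \<Rightarrow> 'a) \<Rightarrow> (nat \<times> nat \<times> (real^'n)) set \<Rightarrow>
     (nat \<Rightarrow> real^'n) \<Rightarrow> ('a, 'n) network" where
  "orbit_network M I q S P =
     \<lparr>verts = {act M l (q i) | l i. l \<in> lat M \<and> i \<in> I},
      edges = {{act M l (q i), act M (l + m) (q j)} | l i j m.
                 l \<in> lat M \<and> (i, j, m) \<in> S \<and> q i \<noteq> act M m (q j)},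
      pos = (\<lambda>v. pos M v + (\<Sum>i\<in>{i \<in> I. v \<in> vertex_orbit M (q i)}. P i - pos M (q i))),
      lat = lat M,
      act = act M\<rparr>"

lemma verts_orbit_network: "verts (orbit_network M I q S P) = {act M l (q i) | l i. l \<in> lat M \<and> i \<in> I}"
  by (simp add: orbit_network_def)

lemma lat_orbit_network [simp]: "lat (orbit_network M I q S P) = lat M"
  and act_orbit_network [simp]: "act (orbit_network M I q S P) = act M"
  by (simp_all add: orbit_network_def)

context oriented_network
begin

lemma mem_vertex_orbit_iff:
  assumes "i \<in> I" "j \<in> I" "l \<in> lat N"
  shows "act N l (q i) \<in> vertex_orbit N (q j) \<longleftrightarrow> i = j"
  unfolding vertex_orbit_def using assms by (auto simp: act_q_eq_iff)

lemma pos_orbit_network: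
  assumes "J \<subseteq> I" "i \<in> J" "l \<in> lat N"
  shows "pos (orbit_network N J q T P) (act N l (q i)) = P i + l"
proof -
  have "{j \<in> J. act N l (q i) \<in> vertex_orbit N (q j)} = {i}"
    using assms by (auto simp: mem_vertex_orbit_iff subset_iff)
  then show ?thesis
    using assms by (simp add: orbit_network_def subset_iff algebra_simps)
qed

lemma edgeI:
  assumes "(i, j, m) \<in> S" "l \<in> lat N"
  shows "{act N l (q i), act N (l + m) (q j)} \<in> edges N"
proof -
  have "{act N l (q i), act N (l + m) (q j)} = act N l ` seg_edge N q (i, j, m)"
    using assms segD[OF assms(1)] by (simp add: seg_edge_def)
  then show ?thesis
    unfolding edges_eq using assms by blast
qed

lemma edge_step: "(i, j, m) \<in> S \<Longrightarrow> l \<in> lat N \<Longrightarrow>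
    (act N l (q i), act N (l + m) (q j)) \<in> {(x, y). {x, y} \<in> edges N}"
  using edgeI by simp

lemma edge_step_back:
  assumes "(i, j, m) \<in> S" "l \<in> lat N"
  shows "(act N l (q j), act N (l - m) (q i)) \<in> {(x, y). {x, y} \<in> edges N}"
  using edgeI[OF assms(1), of "l - m"] assms segD[OF assms(1)] by (simp add: insert_commute)

text \<open>The laws of the action are inherited from \<open>N\<close>; only the new segments and
  positions need checking. The index set may shrink to \<open>J\<close>, as it does for the
  degenerate network.\<close>

lemma oriented_orbit_network:
  assumes J: "J \<subseteq> I" and T: "finite T" "T \<subseteq> J \<times> J \<times> lat N" "\<And>i j m. (i, j, m) \<in> T \<Longrightarrow> i < j"
  shows "oriented_network (orbit_network N J q T P) J q T"
proof unfold_locales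
  let ?N = "orbit_network N J q T P"
  have verts: "verts ?N = {act N l (q i) | l i. l \<in> lat N \<and> i \<in> J}"
    by (rule verts_orbit_network)
  have sub: "verts ?N \<subseteq> verts N"
    unfolding verts verts_eq using J by blast
  have act_v: "act N l v \<in> verts ?N" "pos ?N (act N l v) = pos ?N v + l"
    if l: "l \<in> lat N" and "v \<in> verts ?N" for l v
  proof -
    obtain k i where v: "k \<in> lat N" "i \<in> J" "v = act N k (q i)"
      using \<open>v \<in> verts ?N\<close> unfolding verts by blast
    then have *: "act N l v = act N (l + k) (q i)"
      using l J by auto
    show "act N l v \<in> verts ?N"
      unfolding * verts using v l add_mem by blast
    show "pos ?N (act N l v) = pos ?N v + l"
      unfolding * unfolding v(3) using v l J by (simp add: pos_orbit_network)
  qed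
  have act_e: "act N l ` e \<in> edges ?N" if l: "l \<in> lat N" and "e \<in> edges ?N" for l e
  proof -
    obtain k i j m where e: "e = {act N k (q i), act N (k + m) (q j)}" "k \<in> lat N" "(i, j, m) \<in> T"
        "q i \<noteq> act N m (q j)"
      using \<open>e \<in> edges ?N\<close> unfolding orbit_network_def by auto
    have "i \<in> I" "j \<in> I" "m \<in> lat N"
      using e(3) T(2) J by auto
    then have "act N l ` e = {act N (l + k) (q i), act N ((l + k) + m) (q j)}"
      using e(1,2) l by (simp add: add.assoc)
    moreover have "l + k \<in> lat N"
      using l e(2) by simp
    ultimately show ?thesis
      unfolding orbit_network_def network.select_convs using e(3,4) by blast
  qed
  show "lattice_invariant ?N"
    unfolding lattice_invariant_def lat_orbit_network act_orbit_network
  proof (intro conjI ballI)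
    show "is_lattice (lat N)"
      using inv unfolding lattice_invariant_def by (elim conjE)
    show "act N 0 v = v" if "v \<in> verts ?N" for v
      using that sub by (intro act_zero) blast
    show "act N (l + m) v = act N l (act N m v)" if "l \<in> lat N" "m \<in> lat N" "v \<in> verts ?N" for l m v
      using that sub by (intro act_act[symmetric]) blast+
    show "act N l v \<in> verts ?N" "pos ?N (act N l v) = pos ?N v + l" if "l \<in> lat N" "v \<in> verts ?N" for l v
      using act_v that by auto
    show "act N l ` e \<in> edges ?N" if "l \<in> lat N" "e \<in> edges ?N" for l e
      using act_e that by auto
  qed
  show "segment_orbit ?N J q T"
    unfolding segment_orbit_def orbit_network_def using finite_subset[OF J finite_I] T(1,2)
    by simp
  show "nondegenerate ?N J q"
    using nd J unfolding nondegenerate_def by auto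
qed (rule T(3))

lemma orbit_network_self: "orbit_network N I q S (\<lambda>i. pos N (q i)) = N"
  using seg unfolding segment_orbit_def orbit_network_def by (intro network.equality) simp_all

text \<open>Connectedness is transported along the equivariant vertex map induced by
  \<open>\<kappa>\<close>, which is the identity for the two generic types and merges
  \<open>C\<close> into \<open>A\<close> for the degenerate one.\<close>

lemma connected_orbit_network:
  assumes N: "connected_graph N" and J: "J \<subseteq> I" and \<kappa>: "\<kappa> ` I = J"
    and reach: "\<And>i j m l. (i, j, m) \<in> S \<Longrightarrow> l \<in> lat N \<Longrightarrow>
      (act N l (q (\<kappa> i)), act N (l + m) (q (\<kappa> j))) \<in> {(x, y). {x, y} \<in> edges (orbit_network N J q T P)}\<^sup>*"
  shows "connected_graph (orbit_network N J q T P)"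
proof -
  let ?R = "{(x, y). {x, y} \<in> edges (orbit_network N J q T P)}"
  \<comment> \<open>Decodes a vertex into its unique pair of translation and generator, so that
    \<open>\<kappa>\<close> can act on vertices.\<close>
  define w where "w = inv_into (lat N \<times> I) (\<lambda>(l, i). act N l (q i))"
  define h where "h v = (case w v of (l, i) \<Rightarrow> act N l (q (\<kappa> i)))" for v
  have "inj_on (\<lambda>(l, i). act N l (q i)) (lat N \<times> I)"
    by (auto simp: inj_on_def act_q_eq_iff)
  then have "w (act N l (q i)) = (l, i)" if "l \<in> lat N" "i \<in> I" for l i
    using inv_into_f_f[of "\<lambda>(l, i). act N l (q i)" "lat N \<times> I" "(l, i)"] that by (simp add: w_def)
  then have h: "h (act N l (q i)) = act N l (q (\<kappa> i))" if "l \<in> lat N" "i \<in> I" for l i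
    using that by (simp add: h_def)
  have verts: "verts (orbit_network N J q T P) = {act N l (q i) | l i. l \<in> lat N \<and> i \<in> J}"
    by (rule verts_orbit_network)
  have sym: "sym (?R\<^sup>*)"
    by (rule sym_rtrancl) (auto simp: sym_def insert_commute)
  show ?thesis
  proof (rule connected_graph_image[OF N])
    show "h ` verts N = verts (orbit_network N J q T P)"
    proof (intro equalityI subsetI)
      fix x assume "x \<in> h ` verts N"
      then obtain l i where "l \<in> lat N" "i \<in> I" "x = h (act N l (q i))"
        unfolding verts_eq by blast
      then show "x \<in> verts (orbit_network N J q T P)"
        unfolding verts using h \<kappa> by blast
    next
      fix x assume "x \<in> verts (orbit_network N J q T P)"
      then obtain l i where x: "l \<in> lat N" "i \<in> J" "x = act N l (q i)"
        unfolding verts by blast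
      then obtain i' where i': "i' \<in> I" "i = \<kappa> i'"
        using \<kappa> by blast
      then have "x = h (act N l (q i'))"
        using h x by simp
      then show "x \<in> h ` verts N"
        unfolding verts_eq using x(1) i'(1) by blast
    qed
  next
    fix u v assume "{u, v} \<in> edges N"
    then obtain l s where ls: "l \<in> lat N" "s \<in> S" "{u, v} = act N l ` seg_edge N q s"
      unfolding edges_eq by auto
    obtain i j m where s: "s = (i, j, m)" by (cases s)
    note D = segD[OF ls(2)[unfolded s]]
    have r: "(h (act N l (q i)), h (act N (l + m) (q j))) \<in> ?R\<^sup>*"
      using reach[OF ls(2)[unfolded s] ls(1)] D ls(1) by (simp add: h)
    have "{u, v} = {act N l (q i), act N (l + m) (q j)}"
      using ls D by (simp add: s seg_edge_def)
    then consider "u = act N l (q i)" "v = act N (l + m) (q j)"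
      | "v = act N l (q i)" "u = act N (l + m) (q j)"
      by (auto simp: doubleton_eq_iff)
    then show "(h u, h v) \<in> ?R\<^sup>*"
      using r symD[OF sym r] by cases auto
  qed
qed

end

section \<open>Coordinates and the length function\<close>

text \<open>The sine of 60 degrees.\<close>

definition s3 :: real where "s3 = sqrt 3 / 2"

lemma s3_pos: "0 < s3" and s3_sq: "s3\<^sup>2 = 3/4"
  by (simp_all add: s3_def power_divide)

lemma s3_mult: "s3 * s3 = 3/4"
  using s3_sq by (simp add: power2_eq_square)

lemma s3_less: "s3 < 8661/10000" and s3_greater: "866/1000 < s3"
  using power2_less_imp_less[of s3 "8661/10000"] power2_less_imp_less[of "866/1000" s3] s3_pos
  by (simp_all add: s3_sq power_divide)

lemma sqrt2_less: "sqrt 2 < 14143/10000" and sqrt2_greater: "1414/1000 < sqrt (2::real)"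
  by (rule real_less_lsqrt, simp_all add: power2_eq_square)
    (use real_less_rsqrt[of "1414/1000" 2] in \<open>simp add: power2_eq_square\<close>)

locale orthoframe =
  fixes a c n :: "real^3"
  assumes unit [simp]: "a \<bullet> a = 1" "c \<bullet> c = 1" "n \<bullet> n = 1"
    and orth [simp]: "a \<bullet> c = 0" "a \<bullet> n = 0" "c \<bullet> n = 0"
begin

lemma orth' [simp]: "c \<bullet> a = 0" "n \<bullet> a = 0" "n \<bullet> c = 0"
  using orth by (simp_all add: inner_commute)

definition fvec :: "real \<Rightarrow> real \<Rightarrow> real \<Rightarrow> real^3" where
  "fvec x y z = x *\<^sub>R a + y *\<^sub>R c + z *\<^sub>R n"

lemma vec_arith [simp]:
  "fvec x y z + fvec x' y' z' = fvec (x + x') (y + y') (z + z')"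
  "fvec x y z - fvec x' y' z' = fvec (x - x') (y - y') (z - z')"
  "- fvec x y z = fvec (- x) (- y) (- z)"
  "r *\<^sub>R fvec x y z = fvec (r * x) (r * y) (r * z)"
  "p + fvec x y z - (p + fvec x' y' z') = fvec (x - x') (y - y') (z - z')"
  "p + fvec x y z + fvec x' y' z' = p + fvec (x + x') (y + y') (z + z')"
  by (simp_all add: fvec_def algebra_simps)

lemma vec_inner [simp]: "fvec x y z \<bullet> fvec x' y' z' = x * x' + y * y' + z * z'"
  by (simp add: fvec_def inner_add_left inner_add_right)

lemma norm_vec: "norm (fvec x y z) = sqrt (x\<^sup>2 + y\<^sup>2 + z\<^sup>2)"
  by (simp add: norm_eq_sqrt_inner power2_eq_square)

lemma vec_0 [simp]: "fvec 0 0 0 = 0"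
  by (simp add: fvec_def)

lemma vec_eq_iff [simp]: "fvec x y z = fvec x' y' z' \<longleftrightarrow> x = x' \<and> y = y' \<and> z = z'"
proof
  assume "fvec x y z = fvec x' y' z'"
  then have "fvec x y z \<bullet> v = fvec x' y' z' \<bullet> v" for v by simp
  from this[of "fvec 1 0 0"] this[of "fvec 0 1 0"] this[of "fvec 0 0 1"]
  show "x = x' \<and> y = y' \<and> z = z'" by simp
qed simp

lemma vec_eq_0_iff [simp]: "fvec x y z = 0 \<longleftrightarrow> x = 0 \<and> y = 0 \<and> z = 0"
  using vec_eq_iff[of x y z 0 0 0] unfolding vec_0 .

lemma zero_eq_vec_iff [simp]: "0 = fvec x y z \<longleftrightarrow> x = 0 \<and> y = 0 \<and> z = 0"
  using vec_eq_0_iff[of x y z] by metis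

text \<open>The translations that close up \<open>e_2\<close>, \<open>e_4\<close> and
  \<open>e_6\<close> once \<open>e_1\<close>, \<open>e_3\<close> and \<open>e_5\<close> are lifted
  with translation 0. The vertical part 3/2 is \<open>1/2 + 1/2 + (x_5 + x_6)\<close>.\<close>

definition m2 :: "real^3" where "m2 = fvec (- 2 * s3) 0 0"
definition m4 :: "real^3" where "m4 = fvec 0 (- 2 * s3) 0"
definition m6 :: "real^3" where "m6 = fvec s3 (- s3) (- 3/2)"

lemma m_nz [simp]: "m2 \<noteq> 0" "m4 \<noteq> 0" "0 \<noteq> m2" "0 \<noteq> m4"
  using s3_pos by (simp_all add: m2_def m4_def)

text \<open>The vertices \<open>A, B, C, D\<close> are numbered \<open>0, 1, 2, 3\<close>. In \<open>segs_K4\<close> the edges \<open>e\<^sub>2\<close> and \<open>e\<^sub>3\<close>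
  have exchanged their ends \<open>A\<close> and \<open>C\<close>; \<open>segs_0\<close> is the common degeneration, with \<open>C\<close>
  identified with \<open>A\<close>.\<close>

definition segs_ths :: "(nat \<times> nat \<times> (real^3)) set" where
  "segs_ths = {(0, 1, 0), (0, 1, m2), (2, 3, 0), (2, 3, m4), (0, 2, 0), (1, 3, m6)}"
definition segs_K4 :: "(nat \<times> nat \<times> (real^3)) set" where
  "segs_K4 = {(0, 1, 0), (1, 2, - m2), (0, 3, 0), (2, 3, m4), (0, 2, 0), (1, 3, m6)}"
definition segs_0 :: "(nat \<times> nat \<times> (real^3)) set" where
  "segs_0 = {(0, 1, 0), (0, 1, m2), (0, 3, 0), (0, 3, m4), (1, 3, m6)}"

text \<open>One formula for all phases: \<open>\<sigma>\<close> separates \<open>A\<close> from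
  \<open>C\<close> horizontally, \<open>y\<close> is the length of the vertical \<open>e_5\<close>,
  and \<open>h\<close> is the vertical offset from \<open>A\<close> down to \<open>B\<close> and
  from \<open>C\<close> up to \<open>D\<close>. The type \<open>D1_box_D2\<close> has
  \<open>\<sigma> = 0\<close> and \<open>h = 1/2\<close>, the type \<open>K4\<close> has
  \<open>y = 0\<close>.\<close>

definition coords :: "real \<Rightarrow> real \<Rightarrow> real \<Rightarrow> nat \<Rightarrow> real^3" where
  "coords \<sigma> y h i =
     (if i = 0 then fvec \<sigma> \<sigma> 0 else if i = 1 then fvec s3 0 (- h)
      else if i = 2 then fvec (- \<sigma>) (- \<sigma>) y else fvec 0 s3 (h + y))"

lemma coords_simps [simp]:
  "coords \<sigma> y h 0 = fvec \<sigma> \<sigma> 0" "coords \<sigma> y h (Suc 0) = fvec s3 0 (- h)"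
  "coords \<sigma> y h 2 = fvec (- \<sigma>) (- \<sigma>) y" "coords \<sigma> y h 3 = fvec 0 s3 (h + y)"
  by (simp_all add: coords_def)

lemma incident_ths:
  "incident segs_ths 0 = {(1, 0), (1, m2), (2, 0)}"
  "incident segs_ths (Suc 0) = {(0, 0), (0, - m2), (3, m6)}"
  "incident segs_ths 2 = {(3, 0), (3, m4), (0, 0)}"
  "incident segs_ths 3 = {(2, 0), (2, - m4), (1, - m6)}"
  by (auto simp: incident_def segs_ths_def)

lemma incident_K4:
  "incident segs_K4 0 = {(1, 0), (3, 0), (2, 0)}"
  "incident segs_K4 (Suc 0) = {(0, 0), (2, - m2), (3, m6)}"
  "incident segs_K4 2 = {(1, m2), (3, m4), (0, 0)}"
  "incident segs_K4 3 = {(0, 0), (2, - m4), (1, - m6)}"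
  by (auto simp: incident_def segs_K4_def)

lemma incident_0:
  "incident segs_0 0 = {(1, 0), (1, m2), (3, 0), (3, m4)}"
  "incident segs_0 (Suc 0) = {(0, 0), (0, - m2), (3, m6)}"
  "incident segs_0 3 = {(0, 0), (0, - m4), (1, - m6)}"
  by (auto simp: incident_def segs_0_def)

text \<open>Four edges of equal length by symmetry, then the edge \<open>A C\<close> with vector
  \<open>(2\<sigma>, 2\<sigma>, 0)\<close> up to sign, then the vertical \<open>e_6\<close>.\<close>

definition K4_length :: "real \<Rightarrow> real \<Rightarrow> real" where
  "K4_length \<sigma> h = 4 * norm (fvec (s3 - \<sigma>) (- \<sigma>) (- h)) + 2 * sqrt 2 * \<sigma> + (3/2 - 2 * h)"

text \<open>The critical point of the convex function \<open>K4_length\<close>.\<close>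

definition \<sigma>1 :: real where "\<sigma>1 = s3 * (2 - sqrt 2) / 4"
definition h1 :: real where "h1 = s3 / 2"

lemma \<sigma>1_pos: "0 < \<sigma>1" and \<sigma>1_less: "\<sigma>1 < s3 / 2"
  using s3_pos sqrt2_less sqrt2_greater by (simp_all add: \<sigma>1_def field_simps)

lemma h1_bounds: "4/10 < h1" "h1 < 1/2"
  using s3_less s3_greater by (simp_all add: h1_def)

lemma \<sigma>1_sq: "(s3 - \<sigma>1)\<^sup>2 + \<sigma>1\<^sup>2 = 9/16"
proof -
  have "(s3 - \<sigma>1)\<^sup>2 + \<sigma>1\<^sup>2 = s3\<^sup>2 * (((2 + sqrt 2) / 4)\<^sup>2 + ((2 - sqrt 2) / 4)\<^sup>2)"
    unfolding \<sigma>1_def by (simp add: field_simps power2_eq_square)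
  also have "((2 + sqrt 2) / 4)\<^sup>2 + ((2 - sqrt 2) / 4)\<^sup>2 = 3/4"
    by (simp add: field_simps power2_eq_square)
  finally show ?thesis by (simp add: s3_sq)
qed

text \<open>If \<open>r\<close> is this norm, the critical equations read \<open>h = r / 2\<close>
  and \<open>s3 - 2 * \<sigma> = r * sqrt 2 / 2\<close>. Inserted into the norm they leave
  \<open>r = s3\<close>, and this yields the values \<open>\<sigma>1\<close> and
  \<open>h1\<close>.\<close>

lemma norm_K4: "norm (fvec (s3 - \<sigma>1) (- \<sigma>1) (- h1)) = s3"
proof -
  have "(s3 - \<sigma>1)\<^sup>2 + (- \<sigma>1)\<^sup>2 + (- h1)\<^sup>2 = s3\<^sup>2"
    using \<sigma>1_sq s3_sq by (simp add: h1_def power_divide)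
  then show ?thesis
    using s3_pos by (simp add: norm_vec)
qed

lemma K4_length_0: "K4_length 0 (1/2) = 9/2"
proof -
  have "s3\<^sup>2 + (1/2)\<^sup>2 = 1"
    by (simp add: s3_sq power_divide)
  then show ?thesis
    by (simp add: K4_length_def norm_vec)
qed

lemma sqrt2_\<sigma>1: "2 * sqrt 2 * \<sigma>1 = s3 * (sqrt 2 - 1)"
  by (simp add: \<sigma>1_def field_simps)

lemma K4_length_1: "K4_length \<sigma>1 h1 = s3 * (2 + sqrt 2) + 3/2"
  unfolding K4_length_def norm_K4 sqrt2_\<sigma>1 by (simp add: h1_def algebra_simps)

lemma K4_length_1_less: "K4_length \<sigma>1 h1 < 9/2"
proof -
  have "s3 * (2 + sqrt 2) < 8661/10000 * (2 + 14143/10000)"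
    using s3_less sqrt2_less s3_pos sqrt2_greater by (intro mult_strict_mono) auto
  then show ?thesis
    unfolding K4_length_1 by simp
qed

text \<open>A calibration: the norm is bounded below by the inner product with the unit edge vector
  at the critical point. In this bound the terms in \<open>\<sigma>\<close> and \<open>h\<close>
  cancel against the linear part of \<open>K4_length\<close>, and a constant remains.\<close>

lemma K4_length_ge: "K4_length \<sigma>1 h1 \<le> K4_length \<sigma> h"
proof -
  have "(fvec (s3 - \<sigma>) (- \<sigma>) (- h)) \<bullet> (fvec (s3 - \<sigma>1) (- \<sigma>1) (- h1)) \<le>
      norm (fvec (s3 - \<sigma>) (- \<sigma>) (- h)) * s3"
    using norm_cauchy_schwarz[of "fvec (s3 - \<sigma>) (- \<sigma>) (- h)" "fvec (s3 - \<sigma>1) (- \<sigma>1) (- h1)"]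
    unfolding norm_K4 .
  moreover have "(fvec (s3 - \<sigma>) (- \<sigma>) (- h)) \<bullet> (fvec (s3 - \<sigma>1) (- \<sigma>1) (- h1)) =
     s3 * (s3 * (2 + sqrt 2) / 4 - \<sigma> * sqrt 2 / 2 + h / 2)"
    by (simp add: \<sigma>1_def h1_def field_simps)
  ultimately have "s3 * (2 + sqrt 2) / 4 - \<sigma> * sqrt 2 / 2 + h / 2 \<le> norm (fvec (s3 - \<sigma>) (- \<sigma>) (- h))"
    using s3_pos by (simp add: mult.commute)
  then show ?thesis
    unfolding K4_length_1 K4_length_def[of \<sigma>] by argo
qed

definition path_\<sigma> :: "real \<Rightarrow> real" where "path_\<sigma> \<tau> = \<tau> * \<sigma>1"
definition path_h :: "real \<Rightarrow> real" where "path_h \<tau> = 1/2 - \<tau> * (1/2 - h1)"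

text \<open>A convex function on a segment whose minimum is at the far end cannot increase towards
  it.\<close>

lemma K4_length_antimono:
  assumes "\<tau> \<le> \<tau>'" "\<tau>' \<le> 1"
  shows "K4_length (path_\<sigma> \<tau>') (path_h \<tau>') \<le> K4_length (path_\<sigma> \<tau>) (path_h \<tau>)"
proof (cases "\<tau> = 1")
  case False
  \<comment> \<open>The barycentric coordinate of \<open>\<tau>'\<close> between
    \<open>\<tau>\<close> and 1.\<close>
  define r where "r = (1 - \<tau>') / (1 - \<tau>)"
  have r: "0 \<le> r" "r \<le> 1"
    using assms False by (auto simp: r_def)
  have "1 - \<tau>' = r * (1 - \<tau>)"
    using assms False by (simp add: r_def)
  then have \<tau>': "\<tau>' = r * \<tau> + (1 - r)"
    by (simp add: algebra_simps)
  let ?v = "\<lambda>\<tau>. fvec (s3 - path_\<sigma> \<tau>) (- path_\<sigma> \<tau>) (- path_h \<tau>)"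
  have one: "path_\<sigma> 1 = \<sigma>1" "path_h 1 = h1"
    by (simp_all add: path_\<sigma>_def path_h_def)
  have "?v \<tau>' = r *\<^sub>R ?v \<tau> + (1 - r) *\<^sub>R ?v 1"
    by (simp add: \<tau>' path_\<sigma>_def path_h_def algebra_simps)
  then have "norm (?v \<tau>') \<le> norm (r *\<^sub>R ?v \<tau>) + norm ((1 - r) *\<^sub>R ?v 1)"
    by (metis norm_triangle_ineq)
  then have "norm (?v \<tau>') \<le> r * norm (?v \<tau>) + (1 - r) * norm (?v 1)"
    unfolding norm_scaleR using r by simp
  then obtain X' X X1 where X: "X' \<le> r * X + (1 - r) * X1"
      "X' = norm (?v \<tau>')" "X = norm (?v \<tau>)" "X1 = norm (?v 1)"
    by blast
  have "path_\<sigma> \<tau>' = r * path_\<sigma> \<tau> + (1 - r) * path_\<sigma> 1"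
    "path_h \<tau>' = r * path_h \<tau> + (1 - r) * path_h 1"
    by (simp_all add: \<tau>' path_\<sigma>_def path_h_def algebra_simps)
  then have "4 * X' + 2 * sqrt 2 * path_\<sigma> \<tau>' + (3/2 - 2 * path_h \<tau>') \<le>
      4 * (r * X + (1 - r) * X1) + 2 * sqrt 2 * (r * path_\<sigma> \<tau> + (1 - r) * path_\<sigma> 1) +
      (3/2 - 2 * (r * path_h \<tau> + (1 - r) * path_h 1))"
    using X(1) by simp
  then have "K4_length (path_\<sigma> \<tau>') (path_h \<tau>') \<le>
      r * K4_length (path_\<sigma> \<tau>) (path_h \<tau>) + (1 - r) * K4_length \<sigma>1 h1"
    unfolding K4_length_def X(2-4)[unfolded one, symmetric] one
    by (simp add: algebra_simps diff_divide_distrib)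
  also have "\<dots> \<le> r * K4_length (path_\<sigma> \<tau>) (path_h \<tau>) + (1 - r) * K4_length (path_\<sigma> \<tau>) (path_h \<tau>)"
    using r K4_length_ge by (intro add_left_mono mult_left_mono) auto
  finally show ?thesis by (simp add: algebra_simps)
qed (use assms in auto)

end

section \<open>The three combinatorial types\<close>

text \<open>The normal form of a scaled minimizing network: the frame and the base point
  \<open>p\<close> place it in space, and \<open>x5\<close> is its only shape parameter.\<close>

locale ths_network =
  orthoframe a c n + oriented_network N "{0, 1, 2, 3}" q "orthoframe.segs_ths a c n"
  for a c n :: "real^3" and N :: "('a, 3) network" and q :: "nat \<Rightarrow> 'a" +
  fixes p :: "real^3" and x5 :: real
  assumes conn: "connected_graph N"
    and x5: "0 < x5" "x5 < 1/2"
    and pos_q: "i \<in> {0, 1, 2, 3} \<Longrightarrow> pos N (q i) = p + coords 0 x5 (1/2) i"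
begin

lemma m_lat [simp]: "m2 \<in> lat N" "m4 \<in> lat N" "m6 \<in> lat N"
  using segD[of 0 1 m2] segD[of 2 3 m4] segD[of 1 3 m6] by (simp_all add: segs_ths_def)

definition net where "net J T \<sigma> y h = orbit_network N J q T (\<lambda>i. p + coords \<sigma> y h i)"

definition "net_ths y = net {0, 1, 2, 3} segs_ths 0 y (1/2)"
definition "net_K4 \<sigma> h = net {0, 1, 2, 3} segs_K4 \<sigma> 0 h"
definition "net_0 = net {0, 1, 3} segs_0 0 0 (1/2)"

lemmas net_defs = net_ths_def net_K4_def net_0_def

lemma oriented_net:
  "oriented_network (net_ths y) {0, 1, 2, 3} q segs_ths"
  "oriented_network (net_K4 \<sigma> h) {0, 1, 2, 3} q segs_K4"
  "oriented_network net_0 {0, 1, 3} q segs_0"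
  unfolding net_defs net_def
  by (rule oriented_orbit_network; auto simp: segs_ths_def segs_K4_def segs_0_def)+

lemma lat_net [simp]: "lat (net J T \<sigma> y h) = lat N" and act_net [simp]: "act (net J T \<sigma> y h) = act N"
  by (simp_all add: net_def)

lemma pos_net: "J \<subseteq> {0, 1, 2, 3} \<Longrightarrow> i \<in> J \<Longrightarrow> pos (net J T \<sigma> y h) (q i) = p + coords \<sigma> y h i"
  using pos_orbit_network[of J i 0 T "\<lambda>i. p + coords \<sigma> y h i"] by (auto simp: net_defs net_def)

lemma star_ths: "i \<in> {0, 1, 2, 3} \<Longrightarrow> j \<in> {0, 1, 2, 3} \<Longrightarrow>
    oriented_network.star (net_ths y) q i (j, m) = coords 0 y (1/2) j + m - coords 0 y (1/2) i"
  and star_K4: "i \<in> {0, 1, 2, 3} \<Longrightarrow> j \<in> {0, 1, 2, 3} \<Longrightarrow>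
    oriented_network.star (net_K4 \<sigma> h) q i (j, m) = coords \<sigma> 0 h j + m - coords \<sigma> 0 h i"
  and star_0: "i \<in> {0, 1, 3} \<Longrightarrow> j \<in> {0, 1, 3} \<Longrightarrow>
    oriented_network.star net_0 q i (j, m) = coords 0 0 (1/2) j + m - coords 0 0 (1/2) i"
  unfolding oriented_net[THEN oriented_network.star_def] unfolding net_defs by (simp_all add: pos_net)

lemma immersed_ths:
  assumes "0 < y" "y < 1/2"
  shows "immersed (net_ths y)"
proof (rule oriented_network.immersedI[OF oriented_net(1)])
  fix i jm assume "i \<in> {0, 1, 2, 3::nat}" "jm \<in> incident segs_ths i"
  then show "oriented_network.star (net_ths y) q i jm \<noteq> 0"
    using s3_pos assms by (auto simp: incident_ths star_ths m2_def m4_def m6_def)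
next
  fix i jm jm' assume "i \<in> {0, 1, 2, 3::nat}" "jm \<in> incident segs_ths i" "jm' \<in> incident segs_ths i" "jm \<noteq> jm'"
  then show "oriented_network.star (net_ths y) q i jm \<bullet>
      oriented_network.star (net_ths y) q i jm' < 0"
    using s3_pos assms
    by (auto simp: incident_ths star_ths m2_def m4_def m6_def s3_mult)
qed

text \<open>At the vertex of degree 4 two edges from the same former vertex have inner product -1/2,
  and mixed pairs have -1/4.\<close>

lemma immersed_0: "immersed net_0"
proof (rule oriented_network.immersedI[OF oriented_net(3)])
  fix i jm assume "i \<in> {0, 1, 3::nat}" "jm \<in> incident segs_0 i"
  then show "oriented_network.star net_0 q i jm \<noteq> 0"
    using s3_pos by (auto simp: incident_0 star_0 m2_def m4_def m6_def)
next
  fix i jm jm' assume "i \<in> {0, 1, 3::nat}" "jm \<in> incident segs_0 i" "jm' \<in> incident segs_0 i" "jm \<noteq> jm'"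
  then show "oriented_network.star net_0 q i jm \<bullet>
      oriented_network.star net_0 q i jm' < 0"
    using s3_pos
    by (auto simp: incident_0 star_0 m2_def m4_def m6_def s3_mult)
qed

lemma immersed_K4:
  assumes "0 < \<sigma>" "\<sigma> < s3 / 2" "4/10 < h" "h \<le> 1/2"
  shows "immersed (net_K4 \<sigma> h)"
proof -
  have \<sigma>h: "0 < \<sigma> * (s3 - \<sigma>)" "0 < \<sigma> * (s3 - 2 * \<sigma>)" "0 < h * (3/2 - 2 * h)" "0 < h * h"
    using assms by (auto intro!: mult_pos_pos)
  \<comment> \<open>This prepares the one delicate angle, at \<open>B\<close> and at
    \<open>D\<close> between the edges to \<open>A\<close> and \<open>C\<close>, with inner product
    \<open>h^2 - (s3 - \<sigma>)^2 - \<sigma>^2\<close>. It is negative because \<open>h^2\<close>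
    is at most 1/4, while the two squares sum to at least \<open>s3^2 / 2 = 3/8\<close>.\<close>
  have "h * h \<le> 1/2 * (1/2)"
    using assms by (intro mult_mono) auto
  moreover have "0 \<le> (s3 - 2 * \<sigma>) * (s3 - 2 * \<sigma>)"
    by simp
  ultimately have hh: "h * h < (s3 - \<sigma>) * (s3 - \<sigma>) + \<sigma> * \<sigma>"
    using s3_mult by (simp add: algebra_simps)
  show ?thesis
  proof (rule oriented_network.immersedI[OF oriented_net(2)])
    fix i jm assume "i \<in> {0, 1, 2, 3::nat}" "jm \<in> incident segs_K4 i"
    then show "oriented_network.star (net_K4 \<sigma> h) q i jm \<noteq> 0"
      using assms by (auto simp: incident_K4 star_K4 m2_def m4_def m6_def)
  next
    fix i jm jm' assume "i \<in> {0, 1, 2, 3::nat}" "jm \<in> incident segs_K4 i" "jm' \<in> incident segs_K4 i" "jm \<noteq> jm'"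
    then show "oriented_network.star (net_K4 \<sigma> h) q i jm \<bullet>
        oriented_network.star (net_K4 \<sigma> h) q i jm' < 0"
      using \<sigma>h hh s3_mult
      by (auto simp: incident_K4 star_K4 m2_def m4_def m6_def algebra_simps)
  qed
qed

lemma connected_ths: "connected_graph (net_ths y)"
  unfolding net_ths_def net_def
proof (rule connected_orbit_network[OF conn, where \<kappa> = "\<lambda>i. i"])
  fix i j m l assume "(i, j, m) \<in> segs_ths" "l \<in> lat N"
  then show "(act N l (q i), act N (l + m) (q j)) \<in> {(u, v). {u, v} \<in> edges
      (orbit_network N {0, 1, 2, 3} q segs_ths (\<lambda>i. p + coords 0 y (1/2) i))}\<^sup>*"
    using oriented_network.edge_step[OF oriented_net(1), of i j m l y] by (auto simp: net_defs net_def)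
qed auto

lemma connected_0: "connected_graph net_0"
  unfolding net_defs net_def
proof (rule connected_orbit_network[OF conn, where \<kappa> = "\<lambda>i. if i = 2 then 0 else i"])
  fix i j m l assume *: "(i, j, m) \<in> segs_ths" "l \<in> lat N"
  show "(act N l (q (if i = 2 then 0 else i)), act N (l + m) (q (if j = 2 then 0 else j))) \<in>
    {(u, v). {u, v} \<in> edges (orbit_network N {0, 1, 3} q segs_0 (\<lambda>i. p + coords 0 0 (1/2) i))}\<^sup>*"
  proof (cases "(i, j) = (0, 2)")
    \<comment> \<open>The collapsed \<open>e_5\<close> has both ends at one vertex, so the empty
      path suffices.\<close>
    case True
    then show ?thesis using * by (auto simp: segs_ths_def)
  next
    case False
    then have "(if i = 2 then 0 else i, if j = 2 then 0 else j, m) \<in> segs_0"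
      using * by (auto simp: segs_ths_def segs_0_def)
    from oriented_network.edge_step[OF oriented_net(3) this, of l] show ?thesis
      using * by (auto simp: net_defs net_def)
  qed
qed auto

text \<open>Only \<open>e_2\<close> and \<open>e_3\<close> are rerouted, and a detour over
  \<open>e_5\<close> replaces each: from \<open>A\<close> through \<open>C\<close> to the
  \<open>m2\<close>-translate of \<open>B\<close>, and from \<open>C\<close> through
  \<open>A\<close> to \<open>D\<close>.\<close>

lemma connected_K4: "connected_graph (net_K4 \<sigma> h)"
  unfolding net_defs net_def
proof (rule connected_orbit_network[OF conn, where \<kappa> = "\<lambda>i. i"])
  fix i j m l assume *: "(i, j, m) \<in> segs_ths" and l: "l \<in> lat N"
  let ?R = "{(u, v). {u, v} \<in> edges (orbit_network N {0, 1, 2, 3} q segs_K4 (\<lambda>i. p + coords \<sigma> 0 h i))}"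
  have fwd: "(act N l (q i), act N (l + m) (q j)) \<in> ?R" if "(i, j, m) \<in> segs_K4" "l \<in> lat N" for i j m l
    using oriented_network.edge_step[OF oriented_net(2), of i j m l \<sigma> h] that by (simp add: net_defs net_def)
  have bwd: "(act N l (q j), act N (l - m) (q i)) \<in> ?R" if "(i, j, m) \<in> segs_K4" "l \<in> lat N" for i j m l
    using oriented_network.edge_step_back[OF oriented_net(2), of i j m l \<sigma> h] that by (simp add: net_defs net_def)
  consider "(i, j, m) \<in> segs_K4" | "(i, j, m) = (0, 1, m2)" | "(i, j, m) = (2, 3, 0)"
    using * by (auto simp: segs_ths_def segs_K4_def)
  then show "(act N l (q i), act N (l + m) (q j)) \<in> ?R\<^sup>*"
  proof cases
    case 1
    then show ?thesis using fwd l by blast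
  next
    case 2
    have "(act N l (q 0), act N l (q 2)) \<in> ?R"
      using fwd[of 0 2 0 l] l by (simp add: segs_K4_def)
    moreover have "(act N l (q 2), act N (l + m2) (q 1)) \<in> ?R"
      using bwd[of 1 2 "- m2" l] l by (simp add: segs_K4_def)
    ultimately have "(act N l (q 0), act N (l + m2) (q 1)) \<in> ?R\<^sup>*"
      by (rule rtrancl_into_rtrancl[OF r_into_rtrancl])
    then show ?thesis using 2 by simp
  next
    case 3
    have "(act N l (q 2), act N l (q 0)) \<in> ?R"
      using bwd[of 0 2 0 l] l by (simp add: segs_K4_def)
    moreover have "(act N l (q 0), act N l (q 3)) \<in> ?R"
      using fwd[of 0 3 0 l] l by (simp add: segs_K4_def)
    ultimately have "(act N l (q 2), act N l (q 3)) \<in> ?R\<^sup>*"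
      by (rule rtrancl_into_rtrancl[OF r_into_rtrancl])
    then show ?thesis using 3 by simp
  qed
qed auto

lemma periodic_ths: "0 < y \<Longrightarrow> y < 1/2 \<Longrightarrow> periodic_network (net_ths y)"
  by (rule oriented_network.periodicI[OF oriented_net(1) connected_ths immersed_ths])

lemma periodic_0: "periodic_network net_0"
  by (rule oriented_network.periodicI[OF oriented_net(3) connected_0 immersed_0])

lemma periodic_K4: "0 < \<sigma> \<Longrightarrow> \<sigma> < s3 / 2 \<Longrightarrow> 4/10 < h \<Longrightarrow> h \<le> 1/2 \<Longrightarrow>
    periodic_network (net_K4 \<sigma> h)"
  by (rule oriented_network.periodicI[OF oriented_net(2) connected_K4 immersed_K4])

end

section \<open>Unit edge vectors and the two quotient graphs\<close>

context orthoframe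
begin

lemma sgn_vec:
  assumes "x\<^sup>2 + y\<^sup>2 + z\<^sup>2 = r\<^sup>2" "0 < r"
  shows "sgn (fvec x y z) = fvec (x / r) (y / r) (z / r)"
proof -
  have "norm (fvec x y z) = r"
    unfolding norm_vec assms(1) using assms(2) by simp
  then show ?thesis
    by (simp add: sgn_div_norm divide_inverse mult.commute)
qed

text \<open>For the four equally long edges of the final network: \<open>9/16 + 3/16\<close> equals
  \<open>s3^2\<close>.\<close>

lemma sgn_vec_unit_K4:
  assumes "x\<^sup>2 + y\<^sup>2 = 9/16" "z\<^sup>2 = 3/16"
  shows "sgn (fvec x y z) = fvec (x / s3) (y / s3) (z / s3)"
  using assms by (intro sgn_vec) (simp_all add: s3_sq s3_pos)

lemma sgn_vec_diag: "0 < t \<Longrightarrow> sgn (fvec t t 0) = fvec (sqrt 2 / 2) (sqrt 2 / 2) 0"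
  "0 < t \<Longrightarrow> sgn (fvec (- t) (- t) 0) = fvec (- sqrt 2 / 2) (- sqrt 2 / 2) 0"
  by (subst sgn_vec[where r = "sqrt 2 * t"]; simp add: power_mult_distrib real_div_sqrt field_simps)+

lemma sgn_vec_vert: "0 < t \<Longrightarrow> sgn (fvec 0 0 t) = fvec 0 0 1"
  "t < 0 \<Longrightarrow> sgn (fvec 0 0 t) = fvec 0 0 (- 1)"
  by (subst sgn_vec[where r = "\<bar>t\<bar>"]; simp)+

lemma \<sigma>1_div: "\<sigma>1 / s3 = (2 - sqrt 2) / 4" and h1_div: "h1 / s3 = 1/2"
  using s3_pos by (simp_all add: \<sigma>1_def h1_def)

lemma h1_sq: "h1\<^sup>2 = 3/16"
  by (simp add: h1_def power_divide s3_sq)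

lemma card_incident_K4:
  assumes "i \<in> {0, 1, 2, 3}"
  shows "card (incident segs_K4 i) = 3"
  using assms by (auto simp: incident_K4)

lemma D1_box_D2_iso: "multigraph_isomorphic D1_box_D2 (segment_graph {0, 1, 2, 3} segs_ths)"
proof -
  define f :: "dvertex \<Rightarrow> nat" where "f v = (case v of VA \<Rightarrow> 0 | VB \<Rightarrow> 1 | VC \<Rightarrow> 2 | VD \<Rightarrow> 3)" for v
  define g :: "nat \<Rightarrow> nat \<times> nat \<times> (real^3)" where
    "g i = (if i = 1 then (0, 1, 0) else if i = 2 then (0, 1, m2) else if i = 3 then (2, 3, 0)
       else if i = 4 then (2, 3, m4) else if i = 5 then (0, 2, 0) else (1, 3, m6))" for i
  have six: "{1..6::nat} = {1, 2, 3, 4, 5, 6}" by auto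
  have "bij_betw f {VA, VB, VC, VD} {0, 1, 2, 3}"
    by (auto simp: bij_betw_def f_def)
  moreover have "bij_betw g {1..6} segs_ths"
    unfolding six by (auto simp: bij_betw_def g_def segs_ths_def)
  ultimately have "multigraph_iso D1_box_D2 (segment_graph {0, 1, 2, 3} segs_ths) f g"
    by (simp add: multigraph_iso_def D1_box_D2_def segment_graph_def six) (simp add: f_def g_def)
  then show ?thesis
    unfolding multigraph_isomorphic_def by blast
qed

text \<open>The six segments realise each pair of generators exactly once, so forgetting the
  translations is a bijection onto the edges of \<open>K4\<close>.\<close>

lemma K4_iso: "multigraph_isomorphic K4 (segment_graph {0, 1, 2, 3} segs_K4)"
proof -
  define ends :: "nat \<times> nat \<times> (real^3) \<Rightarrow> nat set" where "ends = (\<lambda>(i, j, m). {i, j})"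
  have "ends ` segs_K4 = {e. e \<subseteq> {..<4} \<and> card e = 2}"
  proof (intro equalityI subsetI)
    fix e :: "nat set" assume "e \<in> {e. e \<subseteq> {..<4} \<and> card e = 2}"
    then obtain i j where ij: "e = {i, j}" "i \<noteq> j" "i < 4" "j < 4"
      by (auto simp: card_2_iff)
    then have "i \<in> {0, 1, 2, 3}" "j \<in> {0, 1, 2, 3}" by auto
    then show "e \<in> ends ` segs_K4"
      using ij(1,2) by (auto simp: ends_def segs_K4_def doubleton_eq_iff)
  qed (auto simp: ends_def segs_K4_def)
  then have "bij_betw ends segs_K4 {e. e \<subseteq> {..<4} \<and> card e = 2}"
    unfolding bij_betw_def by (auto simp: inj_on_def ends_def segs_K4_def doubleton_eq_iff)
  then have g: "bij_betw (inv_into segs_K4 ends) {e. e \<subseteq> {..<4} \<and> card e = 2} segs_K4"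
    "\<forall>e \<in> {e. e \<subseteq> {..<4} \<and> card e = 2}. ends (inv_into segs_K4 ends e) = e"
    by (auto simp: bij_betw_inv_into bij_betw_inv_into_right)
  have "{..<4::nat} = {0, 1, 2, 3}" by auto
  then have "multigraph_iso K4 (segment_graph {0, 1, 2, 3} segs_K4) id (inv_into segs_K4 ends)"
    using g unfolding multigraph_iso_def
    by (simp add: complete_multigraph_def segment_graph_def ends_def[symmetric])
  then show ?thesis
    unfolding multigraph_isomorphic_def by blast
qed

end

section \<open>Lengths along the family and the Steiner condition at its end\<close>

context ths_network
begin

lemma dist_vec: "dist (fvec x y z) (fvec x' y' z') = sqrt ((x - x')\<^sup>2 + (y - y')\<^sup>2 + (z - z')\<^sup>2)"
    "dist p (p + fvec x y z) = sqrt (x\<^sup>2 + y\<^sup>2 + z\<^sup>2)"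
  by (simp_all add: dist_norm norm_vec)

lemma sum_segs:
  fixes F :: "nat \<times> nat \<times> (real^3) \<Rightarrow> real"
  shows "sum F segs_ths = F (0, 1, 0) + F (0, 1, m2) + F (2, 3, 0) + F (2, 3, m4) + F (0, 2, 0) + F (1, 3, m6)"
    "sum F segs_0 = F (0, 1, 0) + F (0, 1, m2) + F (0, 3, 0) + F (0, 3, m4) + F (1, 3, m6)"
    "sum F segs_K4 = F (0, 1, 0) + F (1, 2, - m2) + F (0, 3, 0) + F (2, 3, m4) + F (0, 2, 0) + F (1, 3, m6)"
  by (simp_all add: segs_ths_def segs_0_def segs_K4_def)

text \<open>Four edges have length 1, and \<open>y\<close> cancels between \<open>e_5\<close> of
  length \<open>y\<close> and \<open>e_6\<close> of length \<open>1/2 - y\<close>.\<close>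

lemma length_ths: "0 < y \<Longrightarrow> y < 1/2 \<Longrightarrow> network_length (net_ths y) = 9/2"
  unfolding oriented_network.network_length_eq[OF oriented_net(1)] sum_segs unfolding net_defs
  by (simp add: pos_net dist_vec m2_def m4_def m6_def s3_sq power_divide real_sqrt_divide)

lemma length_0: "network_length net_0 = 9/2"
  unfolding oriented_network.network_length_eq[OF oriented_net(3)] sum_segs unfolding net_defs
  by (simp add: pos_net dist_vec m2_def m4_def m6_def s3_sq power_divide real_sqrt_divide)

lemma length_K4:
  assumes "0 < \<sigma>" "h \<le> 1/2"
  shows "network_length (net_K4 \<sigma> h) = K4_length \<sigma> h"
proof -
  have "(2 * \<sigma>)\<^sup>2 + (2 * \<sigma>)\<^sup>2 = (2 * sqrt 2 * \<sigma>)\<^sup>2"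
    by (simp add: power_mult_distrib)
  then have "sqrt ((2 * \<sigma>)\<^sup>2 + (2 * \<sigma>)\<^sup>2) = 2 * sqrt 2 * \<sigma>"
    using assms by (metis less_imp_le mult_nonneg_nonneg real_sqrt_abs abs_of_nonneg
        real_sqrt_ge_0_iff zero_le_numeral)
  moreover have "(\<sigma> - s3)\<^sup>2 = (s3 - \<sigma>)\<^sup>2"
    by (rule power2_commute)
  ultimately show ?thesis
    unfolding oriented_network.network_length_eq[OF oriented_net(2)] sum_segs unfolding net_defs
    using assms
    by (simp add: pos_net dist_vec norm_vec m2_def m4_def m6_def K4_length_def add_ac)
qed

lemma steiner_K4: "steiner_network (net_K4 \<sigma>1 h1)"
  unfolding oriented_network.steiner_iff[OF oriented_net(2)]
proof (intro conjI ballI)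
  show "periodic_network (net_K4 \<sigma>1 h1)"
    using \<sigma>1_pos \<sigma>1_less h1_bounds by (intro periodic_K4) auto
next
  fix i assume i: "i \<in> {0, 1, 2, 3::nat}"
  then show "card (incident segs_K4 i) = 3" by (rule card_incident_K4)
  have sq: "\<sigma>1\<^sup>2 + (s3 - \<sigma>1)\<^sup>2 = 9/16" "\<sigma>1\<^sup>2 + (\<sigma>1 - s3)\<^sup>2 = 9/16" "(\<sigma>1 - s3)\<^sup>2 + \<sigma>1\<^sup>2 = 9/16"
    using \<sigma>1_sq by (simp_all add: power2_commute add.commute)
  have div: "(s3 - \<sigma>1) / s3 = (2 + sqrt 2) / 4" "(\<sigma>1 - s3) / s3 = - (2 + sqrt 2) / 4"
    using s3_pos \<sigma>1_div by (simp_all add: diff_divide_distrib)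
  have sg: "sgn (fvec (2 * \<sigma>1) (2 * \<sigma>1) 0) = fvec (sqrt 2 / 2) (sqrt 2 / 2) 0"
    "sgn (fvec (- (2 * \<sigma>1)) (- (2 * \<sigma>1)) 0) = fvec (- sqrt 2 / 2) (- sqrt 2 / 2) 0"
    using sgn_vec_diag[of "2 * \<sigma>1"] \<sigma>1_pos by simp_all
  have "h1 * 2 - 3/2 < 0" using h1_bounds by simp
  show "(\<Sum>jm\<in>incident segs_K4 i. sgn (oriented_network.star (net_K4 \<sigma>1 h1) q i jm)) = 0"
    using i h1_bounds
    by (auto simp: incident_K4 star_K4 m2_def m4_def m6_def sgn_vec_unit_K4 sq \<sigma>1_sq sg h1_sq div sgn_vec_vert
        \<sigma>1_div h1_div)
      (simp_all add: field_simps)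
qed

end

section \<open>The deformation\<close>

lemma orbit_network_cong:
  "(\<And>i. i \<in> I \<Longrightarrow> P i = P' i) \<Longrightarrow> orbit_network M I q S P = orbit_network M I q S P'"
  unfolding orbit_network_def by simp

text \<open>In this form two sets of segments can be compared one segment at a time.\<close>

lemma segments_eq_UN:
  "{{A l (q i), A (l + m) (q j)} | l i j m. l \<in> L \<and> (i, j, m) \<in> S \<and> q i \<noteq> A m (q j)} =
    (\<Union>(i, j, m)\<in>S. if q i = A m (q j) then {} else (\<lambda>l. {A l (q i), A (l + m) (q j)}) ` L)"
  by (auto split: if_splits) blast

context ths_network
begin

lemma net_ths_self: "net_ths x5 = N"
proof -
  have "net_ths x5 = orbit_network N {0, 1, 2, 3} q segs_ths (\<lambda>i. pos N (q i))"
    unfolding net_ths_def net_def by (intro orbit_network_cong) (simp only: pos_q)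
  then show ?thesis by (simp only: orbit_network_self)
qed

text \<open>With generator 2 redirected to \<open>A\<close>, the segment \<open>(0, 2, 0)\<close>
  yields no edge, and the other five of either type give the edges of \<open>segs_0\<close>.\<close>

lemma segment_orbit_degenerate:
  "segment_orbit net_0 {0, 1, 2, 3} (q(2 := q 0)) segs_ths"
  "segment_orbit net_0 {0, 1, 2, 3} (q(2 := q 0)) segs_K4"
proof -
  let ?q = "q(2 := q 0)"
  note seg0 = oriented_network.seg[OF oriented_net(3), unfolded segment_orbit_def]
  have verts0: "verts net_0 = {act N l (q i) | l i. l \<in> lat N \<and> i \<in> {0, 1, 3}}"
    using seg0 by (simp add: net_0_def)
  have "\<dots> = {act N l (?q i) | l i. l \<in> lat N \<and> i \<in> {0, 1, 2, 3}}"
    by force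
  note verts = verts0[unfolded this]
  have q_eq: "q i = act N m (q j) \<longleftrightarrow> i = j \<and> 0 = m"
    if "i \<in> {0, 1, 2, 3}" "j \<in> {0, 1, 2, 3}" "m \<in> lat N" for i j m
    using act_q_eq_iff[of i j 0 m] that by simp
  have "edges net_0 = {{act N l (q i), act N (l + m) (q j)} | l i j m.
      l \<in> lat N \<and> (i, j, m) \<in> segs_0 \<and> q i \<noteq> act N m (q j)}"
    using seg0 by (simp add: net_0_def)
  note edges0 = this[unfolded segments_eq_UN]
  have e: "edges net_0 = {{act N l (?q i), act N (l + m) (?q j)} | l i j m.
      l \<in> lat N \<and> (i, j, m) \<in> segs_ths \<and> ?q i \<noteq> act N m (?q j)}"
    unfolding segments_eq_UN edges0 by (simp add: segs_0_def segs_ths_def q_eq Un_ac)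
  \<comment> \<open>After the redirection the \<open>K4\<close> segment \<open>(1, 2, - m2)\<close>
    runs from \<open>B\<close> to a translate of \<open>A\<close>. It is \<open>(0, 1, m2)\<close>
    read backwards, and shifting the translation by \<open>m2\<close> identifies the two
    orbits.\<close>
  have swap: "(\<lambda>l. {act N l (q 1), act N (l - m2) (q 0)}) ` lat N =
      (\<lambda>l. {act N l (q 0), act N (l + m2) (q 1)}) ` lat N" (is "?f ` _ = ?g ` _")
  proof (intro equalityI image_subsetI)
    fix l assume l: "l \<in> lat N"
    show "?f l \<in> ?g ` lat N"
      using l by (intro rev_image_eqI[of "l - m2"]) (simp_all add: insert_commute)
    show "?g l \<in> ?f ` lat N"
      using l by (intro rev_image_eqI[of "l + m2"]) (simp_all add: insert_commute)
  qed
  have e': "edges net_0 = {{act N l (?q i), act N (l + m) (?q j)} | l i j m.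
      l \<in> lat N \<and> (i, j, m) \<in> segs_K4 \<and> ?q i \<noteq> act N m (?q j)}"
    unfolding segments_eq_UN edges0 using swap by (simp add: segs_0_def segs_K4_def q_eq Un_ac)
  have sub: "finite segs_ths" "segs_ths \<subseteq> {0, 1, 2, 3} \<times> {0, 1, 2, 3} \<times> lat N"
    "finite segs_K4" "segs_K4 \<subseteq> {0, 1, 2, 3} \<times> {0, 1, 2, 3} \<times> lat N"
    by (auto simp: segs_ths_def segs_K4_def)
  show "segment_orbit net_0 {0, 1, 2, 3} ?q segs_ths"
    unfolding segment_orbit_def using sub verts e by (simp add: net_0_def)
  show "segment_orbit net_0 {0, 1, 2, 3} ?q segs_K4"
    unfolding segment_orbit_def using sub verts e' by (simp add: net_0_def)
qed

lemma collapsed: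
  assumes "(0, 2, 0) \<in> S"
  shows "one_segment_collapsed net_0 {0, 1, 2, 3} (q(2 := q 0)) S"
  unfolding one_segment_collapsed_def
proof (intro exI conjI ballI)
  show "(0, 2, 0) \<in> S" "0 \<noteq> (2::nat)" using assms by auto
  fix i j l assume *: "i \<in> {0, 1, 2, 3::nat}" "j \<in> {0, 1, 2, 3::nat}" "l \<in> lat net_0"
  have q_eq: "q i = act N m (q j) \<longleftrightarrow> i = j \<and> 0 = m"
    if "i \<in> {0, 1, 2, 3}" "j \<in> {0, 1, 2, 3}" "m \<in> lat N" for i j m
    using act_q_eq_iff[of i j 0 m] that by simp
  from * show "(q(2 := q 0)) i = act net_0 l ((q(2 := q 0)) j) \<longleftrightarrow>
      i = j \<and> l = 0 \<or> i = 0 \<and> j = 2 \<and> l = 0 \<or> i = 2 \<and> j = 0 \<and> l = - 0"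
    by (auto simp: net_0_def q_eq)
qed

definition family :: "real \<Rightarrow> ('a, 3) network" where
  "family t = (if t < 0 then net_ths (- t * x5) else if t = 0 then net_0 else net_K4 (path_\<sigma> t) (path_h t))"

lemma lat_family [simp]: "lat (family t) = lat N"
  by (simp add: family_def net_defs)

lemma path_bounds:
  assumes "0 < t" "t \<le> 1"
  shows "0 < path_\<sigma> t" "path_\<sigma> t < s3 / 2" "4/10 < path_h t" "path_h t \<le> 1/2"
proof -
  show "0 < path_\<sigma> t"
    using assms \<sigma>1_pos by (simp add: path_\<sigma>_def)
  have "t * \<sigma>1 \<le> 1 * \<sigma>1"
    using assms \<sigma>1_pos by (intro mult_right_mono) auto
  then show "path_\<sigma> t < s3 / 2"
    using \<sigma>1_less by (simp add: path_\<sigma>_def)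
  have "t * (1/2 - h1) \<le> 1 * (1/2 - h1)"
    using assms h1_bounds by (intro mult_right_mono) auto
  then have "h1 \<le> path_h t"
    by (simp add: path_h_def)
  then show "4/10 < path_h t"
    using h1_bounds(1) by linarith
  show "path_h t \<le> 1/2"
    using assms h1_bounds by (simp add: path_h_def)
qed

lemma collapse_bounds:
  assumes "-1 \<le> t" "t < 0"
  shows "0 < - t * x5" "- t * x5 < 1/2"
proof -
  have "- t * x5 \<le> 1 * x5"
    using assms x5 by (intro mult_right_mono) auto
  then show "- t * x5 < 1/2" using x5 by simp
  show "0 < - t * x5" using assms x5 by (simp add: mult_neg_pos)
qed

lemma periodic_family: "t \<in> {-1..1} \<Longrightarrow> periodic_network (family t)"
  using collapse_bounds[of t] path_bounds[of t]
  by (auto simp: family_def periodic_0 intro: periodic_ths periodic_K4)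

text \<open>\<open>max t 0\<close> freezes the parameter during the collapse, where the constant
  length 9/2 is \<open>K4_length 0 (1/2)\<close>. Monotonicity on the whole interval then follows
  from \<open>K4_length_antimono\<close>.\<close>

lemma length_family:
  assumes "t \<in> {-1..1}"
  shows "network_length (family t) = K4_length (path_\<sigma> (max t 0)) (path_h (max t 0))"
proof -
  consider "t < 0" | "t = 0" | "0 < t" by linarith
  then show ?thesis
  proof cases
    case 1
    then show ?thesis
      using assms collapse_bounds[of t] K4_length_0
      by (simp add: family_def length_ths path_\<sigma>_def path_h_def del: minus_mult_left)
  next
    case 2
    then show ?thesis
      using K4_length_0 by (simp add: family_def length_0 path_\<sigma>_def path_h_def)
  next
    case 3
    then show ?thesis
      using assms path_bounds[of t] by (simp add: family_def length_K4)
  qed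
qed

lemma continuous_family: "continuous_family (lat N) family"
proof -
  \<comment> \<open>At time 0 the orbit of \<open>C\<close> is absent from \<open>net_0\<close>, so
    \<open>A\<close> takes its place as generator. The coordinates of \<open>A\<close> and
    \<open>C\<close> agree there, so the positions do not jump.\<close>
  define Q where "Q t = (if t = 0 then q(2 := q 0) else q)" for t :: real
  have pos_family: "pos (family t) (Q t i) =
      p + coords (path_\<sigma> (max t 0)) (max (- t) 0 * x5) (path_h (max t 0)) i"
    if "i \<in> {0, 1, 2, 3}" for t i
    using that
    by (auto simp: Q_def family_def net_defs pos_net path_\<sigma>_def path_h_def max_def coords_def)
  have cont: "continuous_on {-1..1} (\<lambda>t. pos (family t) (Q t i))" if i: "i \<in> {0, 1, 2, 3}" for i
  proof -
    have "continuous_on {-1..1} (\<lambda>t. p + coords (path_\<sigma> (max t 0)) (max (- t) 0 * x5) (path_h (max t 0)) i)"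
      unfolding coords_def fvec_def path_\<sigma>_def path_h_def
      using i by (auto intro!: continuous_intros)
    then show ?thesis unfolding pos_family[OF i] .
  qed
  have seg_ths: "segment_orbit (family t) {0, 1, 2, 3} (Q t) segs_ths" if "t \<in> {-1..0}" for t
    using that oriented_network.seg[OF oriented_net(1)] segment_orbit_degenerate(1)
    by (simp add: family_def Q_def)
  have seg_K4: "segment_orbit (family t) {0, 1, 2, 3} (Q t) segs_K4" if "t \<in> {0..1}" for t
    using that oriented_network.seg[OF oriented_net(2)] segment_orbit_degenerate(2)
    by (simp add: family_def Q_def)
  have nondeg: "nondegenerate (family t) {0, 1, 2, 3} (Q t)" if "t \<noteq> 0" for t
    using that oriented_network.nd[OF oriented_net(1)] oriented_network.nd[OF oriented_net(2)]
    by (simp add: family_def Q_def)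
  have coll: "one_segment_collapsed (family 0) {0, 1, 2, 3} (Q 0) segs_ths"
    "one_segment_collapsed (family 0) {0, 1, 2, 3} (Q 0) segs_K4"
    using collapsed[of segs_ths] collapsed[of segs_K4]
    by (simp_all add: family_def Q_def segs_ths_def segs_K4_def)
  show ?thesis
    unfolding continuous_family_def using periodic_family cont seg_ths seg_K4 nondeg coll
    by (intro conjI ballI exI[of _ "{0, 1, 2, 3}"] exI[of _ Q] exI[of _ segs_ths] exI[of _ segs_K4])
      auto
qed

lemma quartic_vertex: "\<exists>!v. v \<in> mverts (quotient_graph net_0) \<and> mdegree (quotient_graph net_0) v = 4"
proof -
  have s: "{s \<in> segs_0. fst s = 0 \<or> fst (snd s) = 0} = {(0, 1, 0), (0, 1, m2), (0, 3, 0), (0, 3, m4)}"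
    "{s \<in> segs_0. fst s = 1 \<or> fst (snd s) = 1} = {(0, 1, 0), (0, 1, m2), (1, 3, m6)}"
    "{s \<in> segs_0. fst s = 3 \<or> fst (snd s) = 3} = {(0, 3, 0), (0, 3, m4), (1, 3, m6)}"
    by (auto simp: segs_0_def)
  have d: "mdegree (quotient_graph net_0) (vertex_orbit net_0 (q i)) = (if i = 0 then 4 else 3)"
    if "i \<in> {0, 1, 3}" for i
    unfolding oriented_network.mdegree_quotient[OF oriented_net(3) that]
    using that by (elim insertE emptyE) (simp_all only: s, simp_all)
  show ?thesis
    unfolding oriented_network.mverts_quotient[OF oriented_net(3)]
  proof (rule ex1I[of _ "vertex_orbit net_0 (q 0)"])
    show "vertex_orbit net_0 (q 0) \<in> (\<lambda>i. vertex_orbit net_0 (q i)) ` {0, 1, 3} \<and>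
        mdegree (quotient_graph net_0) (vertex_orbit net_0 (q 0)) = 4"
      using d[of 0] by simp
  next
    fix v assume v: "v \<in> (\<lambda>i. vertex_orbit net_0 (q i)) ` {0, 1, 3} \<and> mdegree (quotient_graph net_0) v = 4"
    then obtain i where i: "i \<in> {0, 1, 3}" "v = vertex_orbit net_0 (q i)" by blast
    then have "i = 0"
      using v d[OF i(1)] by (cases "i = 0") simp_all
    then show "v = vertex_orbit net_0 (q 0)"
      using i(2) by simp
  qed
qed

theorem deformation:
  "continuous_family (lat N) family \<and> family (-1) = N \<and> steiner_network (family 1) \<and>
    (\<forall>t\<in>{-1..1}. lat (family t) = lat N \<and> network_volume (family t) = network_volume N) \<and>
    (\<forall>t\<in>{-1..<0}. multigraph_isomorphic D1_box_D2 (quotient_graph (family t))) \<and>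
    (\<exists>!v. v \<in> mverts (quotient_graph (family 0)) \<and> mdegree (quotient_graph (family 0)) v = 4) \<and>
    (\<forall>t\<in>{0<..1}. multigraph_isomorphic K4 (quotient_graph (family t))) \<and>
    antimono_on {-1..1} (\<lambda>t. network_length (family t)) \<and>
    network_length (family 1) < network_length N"
proof (intro conjI)
  show "continuous_family (lat N) family" by (rule continuous_family)
  show start: "family (-1) = N"
    by (simp add: family_def net_ths_self)
  show "steiner_network (family 1)"
    using steiner_K4 by (simp add: family_def path_\<sigma>_def path_h_def)
  show "\<forall>t\<in>{-1..1}. lat (family t) = lat N \<and> network_volume (family t) = network_volume N"
    by (simp add: network_volume_def)
  show "\<forall>t\<in>{-1..<0}. multigraph_isomorphic D1_box_D2 (quotient_graph (family t))"
    using multigraph_isomorphic_trans[OF D1_box_D2_iso] oriented_network.quotient_iso[OF oriented_net(1)]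
    unfolding multigraph_isomorphic_def family_def by fastforce
  show "\<exists>!v. v \<in> mverts (quotient_graph (family 0)) \<and> mdegree (quotient_graph (family 0)) v = 4"
    using quartic_vertex by (simp add: family_def)
  show "\<forall>t\<in>{0<..1}. multigraph_isomorphic K4 (quotient_graph (family t))"
    using multigraph_isomorphic_trans[OF K4_iso] oriented_network.quotient_iso[OF oriented_net(2)]
    unfolding multigraph_isomorphic_def family_def by fastforce
  show "antimono_on {-1..1} (\<lambda>t. network_length (family t))"
    by (rule monotone_onI) (auto simp: length_family intro!: K4_length_antimono)
  have "network_length (family 1) < 9/2"
    using K4_length_1_less by (simp add: length_family path_\<sigma>_def path_h_def)
  also have "9/2 = network_length (family (-1))"
    using K4_length_0 by (simp add: length_family path_\<sigma>_def path_h_def)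
  finally show "network_length (family 1) < network_length N"
    unfolding start .
qed

end

section \<open>Coordinates for a minimizing network\<close>

context lattice_network
begin

lemma mem_vertex_orbit: "v \<in> verts N \<Longrightarrow> v \<in> vertex_orbit N v"
  unfolding vertex_orbit_def by (rule rev_image_eqI[of 0]) simp_all

lemma vertex_orbit_eq: "v \<in> verts N \<Longrightarrow> u \<in> vertex_orbit N v \<Longrightarrow> vertex_orbit N u = vertex_orbit N v"
  using vertex_orbit_act[of v] unfolding vertex_orbit_def[of N v, THEN eqset_imp_iff] by blast

text \<open>Path lifting for one edge: a representative of \<open>E\<close> has an end in the orbit
  of \<open>a\<close>, and a translation carries this end to \<open>a\<close>.\<close>

lemma quotient_edge_at:
  assumes simple: "simple_graph N"
    and E: "E \<in> medges (quotient_graph N)" "mends (quotient_graph N) E = {vertex_orbit N a, Y}"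
    and a: "a \<in> verts N"
  obtains b where "b \<in> verts N" "Y = vertex_orbit N b" "{a, b} \<in> edges N" "E = edge_orbit N {a, b}"
proof -
  obtain e where e: "e \<in> edges N" "E = edge_orbit N e"
    using E(1) by (auto simp: quotient_graph_def)
  have e_sub: "e \<subseteq> verts N" "card e = 2"
    using simple e(1) by (auto simp: simple_graph_def)
  then obtain u v where uv: "e = {u, v}" "u \<in> verts N" "v \<in> verts N"
    by (auto simp: card_2_iff)
  have "\<Union>E = vertex_orbit N u \<union> vertex_orbit N v"
    unfolding e(2) uv(1) by (auto simp: edge_orbit_def vertex_orbit_def)
  moreover have "vertex_orbit N ` vertex_orbit N w = {vertex_orbit N w}" if "w \<in> verts N" for w
  proof -
    have "vertex_orbit N ` vertex_orbit N w = (\<lambda>_. vertex_orbit N w) ` vertex_orbit N w"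
      by (intro image_cong refl vertex_orbit_eq that)
    then show ?thesis by (simp add: image_constant[OF mem_vertex_orbit[OF that]])
  qed
  ultimately have "{vertex_orbit N u, vertex_orbit N v} = {vertex_orbit N a, Y}"
    using E(2) uv by (simp add: quotient_graph_def image_Un insert_commute)
  then obtain u' v' where uv': "e = {u', v'}" "u' \<in> verts N" "v' \<in> verts N"
      "vertex_orbit N u' = vertex_orbit N a" "Y = vertex_orbit N v'"
    using uv unfolding doubleton_eq_iff by (metis insert_commute)
  have "a \<in> vertex_orbit N u'"
    using mem_vertex_orbit[OF a] uv'(4) by simp
  then obtain l where l: "l \<in> lat N" "a = act N l u'"
    by (auto simp: vertex_orbit_def)
  show thesis
  proof
    show "act N l v' \<in> verts N" "Y = vertex_orbit N (act N l v')"
      using l uv' by (simp_all add: vertex_orbit_act)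
    have *: "{a, act N l v'} = act N l ` e"
      using l uv' by simp
    show "{a, act N l v'} \<in> edges N" "E = edge_orbit N {a, act N l v'}"
      unfolding * using act_edges l e e_sub by (simp_all add: edge_orbit_act)
  qed
qed

lemma vertex_orbit_eqD:
  assumes "u \<in> verts N" "v \<in> verts N" "vertex_orbit N u = vertex_orbit N v"
  obtains l where "l \<in> lat N" "u = act N l v"
  using mem_vertex_orbit[OF assms(1)] assms(3) by (auto simp: vertex_orbit_def)

lemma act_fixed: "l \<in> lat N \<Longrightarrow> v \<in> verts N \<Longrightarrow> v = act N l v \<Longrightarrow> l = 0"
  using pos_act[of l v] by simp

text \<open>A converse to \<open>quotient_iso\<close>: one lift of each vertex and each edge of the
  quotient already presents the whole network.\<close>

lemma oriented_networkI:
  assumes simple: "simple_graph N" and fin: "finite I" "finite S"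
    and S: "S \<subseteq> I \<times> I \<times> lat N" "\<And>i j m. (i, j, m) \<in> S \<Longrightarrow> i < j"
    and q: "\<And>i. i \<in> I \<Longrightarrow> q i \<in> verts N" "inj_on (\<lambda>i. vertex_orbit N (q i)) I"
    and verts: "mverts (quotient_graph N) = (\<lambda>i. vertex_orbit N (q i)) ` I"
    and edges: "medges (quotient_graph N) = (\<lambda>s. edge_orbit N (seg_edge N q s)) ` S"
      "\<And>s. s \<in> S \<Longrightarrow> seg_edge N q s \<in> edges N"
  shows "oriented_network N I q S"
proof unfold_locales
  show nd: "nondegenerate N I q"
    unfolding nondegenerate_def
  proof (intro ballI iffI)
    fix i j l assume *: "i \<in> I" "j \<in> I" "l \<in> lat N" "q i = act N l (q j)"
    then have "vertex_orbit N (q i) = vertex_orbit N (q j)"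
      using q(1) by (simp add: vertex_orbit_act)
    then have "i = j" using inj_onD[OF q(2)] *(1,2) by blast
    then show "i = j \<and> l = 0" using * act_fixed q(1) by blast
  qed (use q(1) in simp)
  have v: "verts N = {act N l (q i) | l i. l \<in> lat N \<and> i \<in> I}"
  proof (intro equalityI subsetI)
    fix v assume v: "v \<in> verts N"
    then have "vertex_orbit N v \<in> mverts (quotient_graph N)"
      by (simp add: quotient_graph_def)
    then obtain i where i: "i \<in> I" "vertex_orbit N v = vertex_orbit N (q i)"
      unfolding verts by blast
    obtain l where "l \<in> lat N" "v = act N l (q i)"
      by (rule vertex_orbit_eqD[OF v q(1)[OF i(1)] i(2)])
    then show "v \<in> {act N l (q i) | l i. l \<in> lat N \<and> i \<in> I}" using i by blast
  qed (use q(1) in auto)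
  have e: "edges N = {{act N l (q i), act N (l + m) (q j)} | l i j m.
      l \<in> lat N \<and> (i, j, m) \<in> S \<and> q i \<noteq> act N m (q j)}" (is "_ = ?E")
  proof (intro equalityI subsetI)
    fix e assume e: "e \<in> edges N"
    have sub: "e \<subseteq> verts N" using simple e by (simp add: simple_graph_def)
    have "edge_orbit N e \<in> medges (quotient_graph N)"
      using e by (simp add: quotient_graph_def)
    then obtain s where s: "s \<in> S" "edge_orbit N e = edge_orbit N (seg_edge N q s)"
      unfolding edges(1) by blast
    have "e \<in> edge_orbit N e"
      unfolding edge_orbit_def using act_image_zero[OF sub] by (intro rev_image_eqI[of 0]) simp_all
    then obtain l where l: "l \<in> lat N" "e = act N l ` seg_edge N q s"
      unfolding s(2) by (auto simp: edge_orbit_def)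
    obtain i j m where ijm: "s = (i, j, m)" by (cases s)
    have *: "q i \<in> verts N" "q j \<in> verts N" "m \<in> lat N" "i \<in> I" "j \<in> I"
      using s(1) S(1) q(1) ijm by auto
    have "i \<noteq> j"
      using S(2)[of i j m] s(1) ijm by blast
    then have "q i \<noteq> act N m (q j)"
      using nd * unfolding nondegenerate_def by blast
    moreover have "e = {act N l (q i), act N (l + m) (q j)}"
      using l ijm * by (simp add: seg_edge_def)
    ultimately show "e \<in> ?E" using l(1) s(1) ijm by blast
  next
    fix e assume "e \<in> ?E"
    then obtain l i j m where e: "e = {act N l (q i), act N (l + m) (q j)}" "l \<in> lat N" "(i, j, m) \<in> S"
      by blast
    have "q i \<in> verts N" "q j \<in> verts N" "m \<in> lat N"
      using e(3) S(1) q(1) by auto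
    then have "e = act N l ` seg_edge N q (i, j, m)"
      using e by (simp add: seg_edge_def)
    then show "e \<in> edges N"
      using act_edges[OF e(2) edges(2)[OF e(3)]] by simp
  qed
  show "segment_orbit N I q S"
    unfolding segment_orbit_def using fin S(1) v e by (intro conjI)
qed (rule S(2))

end

text \<open>Since \<open>u + v = - w\<close> is a unit vector, \<open>u\<close> and \<open>v\<close>
  have inner product -1/2, so \<open>u - v\<close> has squared norm \<open>3 = (2 * s3)^2\<close>.
  Thus \<open>b\<close> completes \<open>w\<close> to an orthonormal basis of the plane of the
  triple.\<close>

lemma steiner_triple_frame:
  fixes u v w :: "'v :: real_inner"
  assumes "norm u = 1" "norm v = 1" "norm w = 1" "u + v + w = 0"
  defines "b \<equiv> (1 / (2 * s3)) *\<^sub>R (u - v)"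
  shows "b \<bullet> b = 1" "b \<bullet> w = 0" "u = s3 *\<^sub>R b - (1/2) *\<^sub>R w" "v = - s3 *\<^sub>R b - (1/2) *\<^sub>R w"
proof -
  have w: "w = - u - v"
    using assms(4) by (metis add_eq_0_iff diff_conv_add_uminus minus_add_distrib)
  have n: "u \<bullet> u = 1" "v \<bullet> v = 1" "w \<bullet> w = 1"
    using assms(1-3) by (simp_all add: norm_eq_1)
  then have uv: "u \<bullet> v = - 1/2"
    unfolding w by (simp add: inner_diff_left inner_diff_right inner_commute)
  have "(u - v) \<bullet> (u - v) = 3"
    using n uv by (simp add: inner_diff_left inner_diff_right inner_commute)
  then have "b \<bullet> b = 1 / (2 * s3) * (1 / (2 * s3)) * 3"
    unfolding b_def by (simp only: inner_scaleR_left inner_scaleR_right mult.assoc)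
  also have "\<dots> = 1"
    using s3_mult s3_pos by (simp add: field_simps)
  finally show "b \<bullet> b = 1" .
  show "b \<bullet> w = 0"
    using n uv by (simp add: b_def w inner_diff_left inner_diff_right inner_commute)
  have b: "s3 *\<^sub>R b = (1/2) *\<^sub>R (u - v)"
    using s3_pos by (simp add: b_def)
  have "s3 *\<^sub>R b - (1/2) *\<^sub>R w = (1/2) *\<^sub>R (u - v - w)"
    "- s3 *\<^sub>R b - (1/2) *\<^sub>R w = (1/2) *\<^sub>R (v - u - w)"
    unfolding scaleR_minus_left b by (simp_all only: scaleR_diff_right minus_diff_eq)
  moreover have "u - v - w = 2 *\<^sub>R u" "v - u - w = 2 *\<^sub>R v"
    by (simp_all add: w scaleR_2)
  ultimately show "u = s3 *\<^sub>R b - (1/2) *\<^sub>R w" "v = - s3 *\<^sub>R b - (1/2) *\<^sub>R w"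
    by simp_all
qed

text \<open>The cross products of \<open>a\<close> and of \<open>c\<close> with \<open>n\<close> are
  normals, and by the Lagrange identity their inner product is that of \<open>a\<close> and
  \<open>c\<close>. Inclusions suffice, because a normal of the span is normal to any subset of
  it.\<close>

lemma perpendicular_planes_inner:
  assumes "perpendicular_planes P Q" "P \<subseteq> span {a, n}" "Q \<subseteq> span {c, n}"
    and "n \<bullet> n = 1" "a \<bullet> n = 0" "c \<bullet> n = 0"
  shows "a \<bullet> c = 0"
proof -
  have *: "cross3 b n \<in> orthogonal_comp R" if "R \<subseteq> span {b, n}" for b R
  proof -
    have "orthogonal (cross3 b n) y" if "y \<in> R" for y
      by (rule orthogonal_to_span[of y "{b, n}"]) (use \<open>R \<subseteq> _\<close> that in \<open>auto simp: orthogonal_cross orthogonal_def dot_cross_self inner_commute\<close>)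
    then show ?thesis by (auto simp: orthogonal_comp_def orthogonal_commute)
  qed
  have "orthogonal (cross3 a n) (cross3 c n)"
    using assms(1) *[OF assms(2)] *[OF assms(3)] unfolding perpendicular_planes_def by blast
  then show ?thesis
    using assms(4-6) by (simp add: orthogonal_def dot_cross inner_commute)
qed

lemma sum_three: "card {x, y, z} = 3 \<Longrightarrow> sum f {x, y, z} = f x + f y + f z"
  by (auto simp: card_insert_if add.assoc split: if_splits)

text \<open>Rigidity: the Steiner condition, the perpendicular planes and the scaling leave free
  only the placement in space and the division of 1/2 into \<open>x_5\<close> and
  \<open>x_6\<close>.\<close>

lemma minimizing_ths_network:
  fixes M :: "('a, 3) network"
  assumes M: "minimizing_ths M f g" and g1: "orbit_length M (g 1) = 1"
  shows "\<exists>a c n q p x5. ths_network a c n M q p x5"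
proof -
  have steiner: "steiner_network M" and iso: "multigraph_iso D1_box_D2 (quotient_graph M) f g"
    and lengths: "orbit_length M (g 2) = 1" "orbit_length M (g 3) = 1" "orbit_length M (g 4) = 1"
      "2 * orbit_length M (g 5) + 2 * orbit_length M (g 6) = 1"
    and perp: "\<And>v w. v \<in> f VA \<Longrightarrow> w \<in> f VC \<Longrightarrow> perpendicular_planes (edge_plane M v) (edge_plane M w)"
    using M g1 unfolding minimizing_ths_def Let_def by auto
  have simple: "simple_graph M" and conn: "connected_graph M" and immersed: "immersed M"
    and inv: "lattice_invariant M"
    using steiner unfolding steiner_network_def periodic_network_def by auto
  interpret lattice_network M by unfold_locales (rule inv)
  let ?Q = "quotient_graph M"
  have f: "bij_betw f {VA, VB, VC, VD} (mverts ?Q)" and g: "bij_betw g {1..6} (medges ?Q)"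
    and ends: "\<And>e. e \<in> {1..6} \<Longrightarrow> mends ?Q (g e) = f ` mends D1_box_D2 e"
    using iso by (auto simp: multigraph_iso_def D1_box_D2_def)
  have gE: "g e \<in> medges ?Q" if "e \<in> {1..6}" for e
    using g that by (auto simp: bij_betw_def)
  have "f VA \<in> mverts ?Q"
    using f by (auto simp: bij_betw_def)
  then obtain A where A: "A \<in> verts M" "f VA = vertex_orbit M A"
    by (auto simp: quotient_graph_def)
  have e1: "mends ?Q (g 1) = {vertex_orbit M A, f VB}" and e2: "mends ?Q (g 2) = {vertex_orbit M A, f VB}"
    and e5: "mends ?Q (g 5) = {vertex_orbit M A, f VC}" and e3: "mends ?Q (g 3) = {f VC, f VD}"
    and e4: "mends ?Q (g 4) = {f VC, f VD}" and e6: "mends ?Q (g 6) = {f VB, f VD}"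
    by (simp_all add: ends D1_box_D2_def A)
  \<comment> \<open>The lifts \<open>B\<close>, \<open>C\<close>, \<open>D\<close> follow the
    spanning tree \<open>e_1\<close>, \<open>e_5\<close>, \<open>e_3\<close>, so these edges get
    translation 0. The other three edges end at translates of \<open>B\<close> or \<open>D\<close>,
    which defines \<open>\<mu>2\<close>, \<open>\<mu>4\<close> and \<open>\<mu>6\<close>.\<close>
  obtain B where B: "B \<in> verts M" "f VB = vertex_orbit M B" "{A, B} \<in> edges M" "g 1 = edge_orbit M {A, B}"
    by (rule quotient_edge_at[OF simple gE e1 A(1)]) auto
  obtain B' where B': "B' \<in> verts M" "f VB = vertex_orbit M B'" "{A, B'} \<in> edges M" "g 2 = edge_orbit M {A, B'}"
    by (rule quotient_edge_at[OF simple gE e2 A(1)]) auto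
  obtain C where C: "C \<in> verts M" "f VC = vertex_orbit M C" "{A, C} \<in> edges M" "g 5 = edge_orbit M {A, C}"
    by (rule quotient_edge_at[OF simple gE e5 A(1)]) auto
  obtain D where D: "D \<in> verts M" "f VD = vertex_orbit M D" "{C, D} \<in> edges M" "g 3 = edge_orbit M {C, D}"
    by (rule quotient_edge_at[OF simple gE e3[unfolded C(2)] C(1)]) auto
  obtain D' where D': "D' \<in> verts M" "f VD = vertex_orbit M D'" "{C, D'} \<in> edges M" "g 4 = edge_orbit M {C, D'}"
    by (rule quotient_edge_at[OF simple gE e4[unfolded C(2)] C(1)]) auto
  obtain D'' where D'': "D'' \<in> verts M" "f VD = vertex_orbit M D''" "{B, D''} \<in> edges M" "g 6 = edge_orbit M {B, D''}"
    by (rule quotient_edge_at[OF simple gE e6[unfolded B(2)] B(1)]) auto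
  obtain \<mu>2 where \<mu>2: "\<mu>2 \<in> lat M" "B' = act M \<mu>2 B"
    by (rule vertex_orbit_eqD[OF B'(1) B(1)]) (use B B' in auto)
  obtain \<mu>4 where \<mu>4: "\<mu>4 \<in> lat M" "D' = act M \<mu>4 D"
    by (rule vertex_orbit_eqD[OF D'(1) D(1)]) (use D D' in auto)
  obtain \<mu>6 where \<mu>6: "\<mu>6 \<in> lat M" "D'' = act M \<mu>6 D"
    by (rule vertex_orbit_eqD[OF D''(1) D(1)]) (use D D'' in auto)
  define q where "q i = (if i = 0 then A else if i = 1 then B else if i = 2 then C else D)" for i :: nat
  have q [simp]: "q 0 = A" "q (Suc 0) = B" "q 2 = C" "q 3 = D" by (simp_all add: q_def)
  define S where "S = {(0::nat, 1::nat, 0), (0, 1, \<mu>2), (2, 3, 0), (2, 3, \<mu>4), (0, 2, 0), (1, 3, \<mu>6)}"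
  have act0: "act M 0 A = A" "act M 0 B = B" "act M 0 C = C" "act M 0 D = D"
    using A B C D by simp_all
  have g_eq: "g 1 = edge_orbit M (seg_edge M q (0, 1, 0))" "g 2 = edge_orbit M (seg_edge M q (0, 1, \<mu>2))"
    "g 3 = edge_orbit M (seg_edge M q (2, 3, 0))" "g 4 = edge_orbit M (seg_edge M q (2, 3, \<mu>4))"
    "g 5 = edge_orbit M (seg_edge M q (0, 2, 0))" "g 6 = edge_orbit M (seg_edge M q (1, 3, \<mu>6))"
    using B(4) B'(4) C(4) D(4) D'(4) D''(4) \<mu>2 \<mu>4 \<mu>6 by (simp_all add: seg_edge_def act0)
  have inj: "f VA \<noteq> f VB" "f VA \<noteq> f VC" "f VA \<noteq> f VD" "f VB \<noteq> f VC" "f VB \<noteq> f VD" "f VC \<noteq> f VD"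
    using f by (auto simp: bij_betw_def)
  have oriented: "oriented_network M {0, 1, 2, 3} q S"
  proof (rule oriented_networkI[OF simple])
    show "inj_on (\<lambda>i. vertex_orbit M (q i)) {0, 1, 2, 3}"
      using inj A(2) B(2) C(2) D(2) by (auto simp: inj_on_def)
    have "mverts ?Q = f ` {VA, VB, VC, VD}"
      using f by (simp add: bij_betw_def)
    then show "mverts ?Q = (\<lambda>i. vertex_orbit M (q i)) ` {0, 1, 2, 3}"
      using A(2) B(2) C(2) D(2) by simp
    have "medges ?Q = g ` {1..6}"
      using g by (simp add: bij_betw_def)
    moreover have "{1..6} = {1, 2, 3, 4, 5, 6::nat}" by auto
    ultimately have "medges ?Q = {g 1, g 2, g 3, g 4, g 5, g 6}" by simp
    then show "medges ?Q = (\<lambda>s. edge_orbit M (seg_edge M q s)) ` S"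
      unfolding g_eq S_def by simp
    show "seg_edge M q s \<in> edges M" if "s \<in> S" for s
      using that B(3) B'(3) C(3) D(3) D'(3) D''(3) \<mu>2 \<mu>4 \<mu>6 by (auto simp: S_def seg_edge_def act0)
    show "q i \<in> verts M" if "i \<in> {0, 1, 2, 3}" for i
      using that A(1) B(1) C(1) D(1) by auto
  qed (auto simp: S_def \<mu>2 \<mu>4 \<mu>6)
  interpret O: oriented_network M "{0, 1, 2, 3}" q S by (rule oriented)
  have inc: "incident S 0 = {(1, 0), (1, \<mu>2), (2, 0)}" "incident S 1 = {(0, 0), (0, - \<mu>2), (3, \<mu>6)}"
      "incident S 2 = {(3, 0), (3, \<mu>4), (0, 0)}"
    by (auto simp: incident_def S_def)
  define u1 where "u1 = pos M B - pos M A"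
  define u2 where "u2 = pos M B + \<mu>2 - pos M A"
  define u3 where "u3 = pos M D - pos M C"
  define u4 where "u4 = pos M D + \<mu>4 - pos M C"
  define w5 where "w5 = pos M C - pos M A"
  define w6 where "w6 = pos M D + \<mu>6 - pos M B"
  have norms: "norm u1 = 1" "norm u2 = 1" "norm u3 = 1" "norm u4 = 1" "2 * norm w5 + 2 * norm w6 = 1"
    using g1 lengths unfolding g_eq
    by (simp_all add: O.orbit_length_seg S_def dist_norm norm_minus_commute u1_def u2_def u3_def u4_def w5_def w6_def)
  have "pos M C \<noteq> pos M A" "pos M D'' \<noteq> pos M B"
    using immersed A(1) B(1) C(3) D''(3) unfolding immersed_def neighbours_def by blast+
  then have w_nz: "w5 \<noteq> 0" "w6 \<noteq> 0"
    using \<mu>6 D(1) by (simp_all add: w5_def w6_def)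
  define n where "n = sgn w5"
  have sgn_unit: "sgn u1 = u1" "sgn u2 = u2" "sgn u3 = u3" "sgn u4 = u4"
    by (simp_all add: sgn_div_norm norms)
  have cards: "card (incident S i) = 3" "(\<Sum>jm\<in>incident S i. sgn (O.star i jm)) = 0" if "i \<in> {0, 1, 2, 3}" for i
    using steiner that unfolding O.steiner_iff by blast+
  have stars: "O.star 0 (1, 0) = u1" "O.star 0 (1, \<mu>2) = u2" "O.star 0 (2, 0) = w5"
    "O.star 1 (0, 0) = - u1" "O.star 1 (0, - \<mu>2) = - u2" "O.star 1 (3, \<mu>6) = w6"
    "O.star 2 (3, 0) = u3" "O.star 2 (3, \<mu>4) = u4" "O.star 2 (0, 0) = - w5"
    by (simp_all add: O.star_def u1_def u2_def u3_def u4_def w5_def w6_def)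
  \<comment> \<open>The balance at \<open>A\<close>, \<open>B\<close> and \<open>C\<close>.
    Comparing \<open>A\<close> with \<open>B\<close> shows that \<open>e_6\<close> points from
    \<open>B\<close> in direction \<open>- n\<close>.\<close>
  have bal: "u1 + u2 + n = 0" "- u1 - u2 + sgn w6 = 0" "u3 + u4 + - n = 0"
    using cards(2)[of 0] cards(2)[of 1] cards(2)[of 2] cards(1)[of 0] cards(1)[of 1] cards(1)[of 2]
    unfolding inc by (simp_all only: sum_three stars sgn_minus sgn_unit n_def) simp_all
  have n: "norm n = 1" "n \<bullet> n = 1"
    using w_nz by (simp_all add: n_def norm_sgn norm_eq_1[symmetric])
  have w5: "w5 = norm w5 *\<^sub>R n"
    by (simp add: n_def sgn_div_norm w_nz)
  have sgn_w6: "sgn w6 = - n"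
    using bal(1,2) by (simp add: algebra_simps eq_neg_iff_add_eq_0)
  have "- norm w6 *\<^sub>R n = norm w6 *\<^sub>R sgn w6"
    unfolding sgn_w6 by simp
  also have "\<dots> = w6"
    by (simp add: sgn_div_norm w_nz)
  finally have w6: "w6 = - norm w6 *\<^sub>R n" ..
  define a where "a = (1 / (2 * s3)) *\<^sub>R (u1 - u2)"
  define c where "c = (1 / (2 * s3)) *\<^sub>R (u3 - u4)"
  note fa = steiner_triple_frame[OF norms(1,2) n(1) bal(1), folded a_def]
  note fc = steiner_triple_frame[OF norms(3,4) _ bal(3), folded c_def]
  \<comment> \<open>At \<open>C\<close> the edge \<open>e_5\<close> leaves in direction
    \<open>- n\<close>, so the \<open>n\<close>-components have the opposite sign to those at
    \<open>A\<close>.\<close>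
  have fc: "c \<bullet> c = 1" "c \<bullet> n = 0" "u3 = s3 *\<^sub>R c + (1/2) *\<^sub>R n" "u4 = - s3 *\<^sub>R c + (1/2) *\<^sub>R n"
    using fc n(1) by simp_all
  have plane: "edge_plane M (q i) = span (O.star i ` incident S i)" if "i \<in> {0, 1, 2, 3}" for i
  proof -
    have "q i = act M 0 (q i)" using that by (auto simp: act0)
    have "{pos M u - pos M (act M 0 (q i)) | u. u \<in> neighbours M (act M 0 (q i))} =
        (\<lambda>u. pos M u - pos M (act M 0 (q i))) ` neighbours M (act M 0 (q i))"
      by blast
    also have "\<dots> = O.star i ` incident S i"
      unfolding O.neighbours_eq[OF that zero_mem] image_image
      by (intro image_cong refl O.pos_diff_star zero_mem)
    finally show ?thesis
      unfolding edge_plane_def using \<open>q i = act M 0 (q i)\<close> by simp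
  qed
  have memsp: "a \<in> span {a, n}" "n \<in> span {a, n}" "c \<in> span {c, n}" "n \<in> span {c, n}"
    by (auto intro: span_base)
  have w5_span: "w5 \<in> span {a, n}" "w5 \<in> span {c, n}"
    using span_scale[OF memsp(2), of "norm w5"] span_scale[OF memsp(4), of "norm w5"]
    unfolding w5[symmetric] .
  have "edge_plane M A \<subseteq> span {a, n}"
    unfolding plane[of 0, simplified] inc using memsp
    by (intro span_minimal) (auto simp: stars[simplified] fa(3,4) w5_span intro!: span_add span_diff span_scale span_neg)
  moreover have "edge_plane M C \<subseteq> span {c, n}"
    unfolding plane[of 2, simplified] inc using memsp
    by (intro span_minimal) (auto simp: stars[simplified] fc(3,4) w5_span intro!: span_add span_diff span_scale span_neg)
  moreover have "perpendicular_planes (edge_plane M A) (edge_plane M C)"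
    using perp mem_vertex_orbit A C by simp
  ultimately have ac: "a \<bullet> c = 0"
    using perpendicular_planes_inner[of "edge_plane M A" "edge_plane M C" a n c] n(2) fa(2) fc(2) by blast
  interpret orthoframe a c n
    using fa(1,2) fc(1,2) n(2) ac by unfold_locales
  have uw: "u1 = fvec s3 0 (- 1/2)" "u3 = fvec 0 s3 (1/2)" "w5 = fvec 0 0 (norm w5)" "w6 = fvec 0 0 (- norm w6)"
    "u2 = fvec (- s3) 0 (- 1/2)" "u4 = fvec 0 (- s3) (1/2)"
  proof -
    show "w5 = fvec 0 0 (norm w5)" "w6 = fvec 0 0 (- norm w6)"
      by (rule trans[OF w5], simp add: fvec_def) (rule trans[OF w6], simp add: fvec_def)
  qed (simp_all add: fa(3,4) fc(3,4) fvec_def)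
  have "\<mu>2 = u2 - u1"
    by (simp add: u1_def u2_def)
  then have \<mu>2_eq: "\<mu>2 = m2"
    unfolding uw(1,5) by (simp add: m2_def)
  have "\<mu>4 = u4 - u3"
    by (simp add: u3_def u4_def)
  then have \<mu>4_eq: "\<mu>4 = m4"
    unfolding uw(2,6) by (simp add: m4_def)
  have \<mu>6_eq: "\<mu>6 = m6"
  proof -
    \<comment> \<open>The period along the cycle through \<open>e_1\<close>, \<open>e_6\<close>,
      \<open>e_3\<close> and \<open>e_5\<close>. Its vertical part depends only on
      \<open>x_5 + x_6\<close>.\<close>
    have "\<mu>6 = u1 - u3 - w5 + w6"
      by (simp add: u1_def u3_def w5_def w6_def)
    also have "\<dots> = fvec s3 (- s3) (- 1/2 - 1/2 - norm w5 - norm w6)"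
      by (subst uw(1), subst uw(2), subst uw(3), subst uw(4)) simp
    also have "\<dots> = m6"
      using norms(5) by (simp add: m6_def)
    finally show ?thesis .
  qed
  have S_eq: "S = segs_ths"
    by (simp add: S_def segs_ths_def \<mu>2_eq \<mu>4_eq \<mu>6_eq)
  have pos_q: "pos M (q i) = pos M A + coords 0 (norm w5) (1/2) i" if "i \<in> {0, 1, 2, 3}" for i
  proof -
    have "pos M B = pos M A + fvec s3 0 (- 1/2)" "pos M C = pos M A + fvec 0 0 (norm w5)"
      unfolding uw(1)[symmetric] uw(3)[symmetric] by (simp_all add: u1_def w5_def)
    moreover from this have "pos M D = pos M A + fvec 0 s3 (1/2 + norm w5)"
    proof -
      have "pos M D = pos M A + (w5 + u3)" by (simp add: u3_def w5_def)
      also have "w5 + u3 = fvec 0 s3 (1/2 + norm w5)"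
        by (subst uw(2), subst uw(3)) simp
      finally show ?thesis .
    qed
    ultimately show ?thesis using that by auto
  qed
  have "0 < norm w5" "0 < norm w6"
    using w_nz by simp_all
  then have x5: "0 < norm w5" "norm w5 < 1/2"
    using norms(5) by linarith+
  have "ths_network a c n M q (pos M A) (norm w5)"
    by (intro ths_network.intro ths_network_axioms.intro orthoframe_axioms oriented[unfolded S_eq] conn x5 pos_q)
  then show ?thesis by blast
qed

theorem theorem7p1:
  fixes M :: "('a, 3) network" and \<Lambda>\<^sub>0 :: "(real^3) set"
    and f :: "dvertex \<Rightarrow> 'a set" and g :: "nat \<Rightarrow> 'a set set"
  assumes "minimizing_ths M f g"
    and "orbit_length M (g 1) = 1"
    and "lat M = \<Lambda>\<^sub>0"
  shows "\<exists>N :: real \<Rightarrow> ('a, 3) network.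
    continuous_family \<Lambda>\<^sub>0 N \<and>
    N (-1) = M \<and> steiner_network (N 1) \<and>
    (\<forall>t\<in>{-1..1}. lat (N t) = \<Lambda>\<^sub>0 \<and> network_volume (N t) = network_volume M) \<and>
    (\<forall>t\<in>{-1..<0}. multigraph_isomorphic D1_box_D2 (quotient_graph (N t))) \<and>
    (\<exists>!v. v \<in> mverts (quotient_graph (N 0)) \<and> mdegree (quotient_graph (N 0)) v = 4) \<and>
    (\<forall>t\<in>{0<..1}. multigraph_isomorphic K4 (quotient_graph (N t))) \<and>
    antimono_on {-1..1} (\<lambda>t. network_length (N t)) \<and>
    network_length (N 1) < network_length M"
proof -
  obtain a c n q p x5 where "ths_network a c n M q p x5"
    using minimizing_ths_network[OF assms(1,2)] by blast
  then interpret ths_network a c n M q p x5 .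
  show ?thesis
    by (rule exI[where x = family]) (rule deformation[unfolded assms(3)])
qed

end
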